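(* For any pseudo-reflection group $G \subset \mathrm{GL}(V)$ with $r = \dim(V/V^G)$, the exterior derivative cochain complex $$0 \to K \to \mathcal{SH}_G^0 \xrightarrow{\mathrm{d}} \mathcal{SH}_G^1 \xrightarrow{\mathrm{d}} \cdots \xrightarrow{\mathrm{d}} \mathcal{SH}_G^r \xrightarrow{\mathrm{d}} 0$$ is exact, where $K\to\mathcal{SH}_G^0$ is the inclusion of constants.
   Context: Setting. $K \subset \mathbb{C}$ is a subfield closed under complex conjugation, $V = K^n$. A pseudo-reflection group $G \subset \mathrm{GL}(V)$ is a finite group of unitary matrices generated by pseudo-reflections (non-identity transformations of finite order fixing a hyperplane pointwise). $V^G$ is the space of $G$-fixed vectors. Differential forms. $x_1,\dots,x_n$ are the coordinate functions on $V$. $K[x_1,\dots,x_n,\theta_1,\dots,\theta_n]$ is the $K$-algebra with $x_ix_j=x_jx_i$, $x_i\theta_j=\theta_jx_i$, $\theta_i\theta_j=-\theta_j\theta_i$ (so $\theta_i^2=0$), bigraded by $x$-degree and $\theta$-degree. $G$ acts by $K$-algebra automorphisms with $\sigma\cdot x_j=\sum_i\overline{\sigma_{ij}}x_i$, $\sigma\cdot\theta_j=\sum_i\overline{\sigma_{ij}}\theta_i$. $\partial_{x_i}$ is the usual ($\theta$-linear) partial derivative; $\partial_{\theta_i}$ is the $x$-linear interior product: for $i_1<\dots<i_k$, $\partial_{\theta_i}\theta_{i_1}\cdots\theta_{i_k}=(-1)^{\ell-1}\theta_{i_1}\cdots\widehat{\theta_{i_\ell}}\cdots\theta_{i_k}$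 if $i=i_\ell$, and $0$ otherwise. For $\omega=\sum c_{\alpha,I}x^\alpha\theta_{i_1}\cdots\theta_{i_k}$ put $\partial_\omega=\sum\overline{c_{\alpha,I}}\,\partial_{x_1}^{\alpha_1}\cdots\partial_{x_n}^{\alpha_n}\partial_{\theta_{i_k}}\cdots\partial_{\theta_{i_1}}$. Super harmonics. $\mathcal{J}_G$ is the ideal of $K[x_1,\dots,x_n,\theta_1,\dots,\theta_n]$ generated by the bi-homogeneous $G$-invariant elements of positive total degree, and $\mathcal{SH}_G=\{\eta:\partial_\omega\eta=0\text{ for all }\omega\in\mathcal{J}_G\}$; $\mathcal{SH}_G^k$ is its $\theta$-degree $k$ component. Exterior derivative. $\mathrm{d}=\sum_{i=1}^n\partial_{x_i}\theta_i$, where $\theta_i$ denotes left multiplication by $\theta_i$. *)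

theory Defs
  imports
    "HOL-Analysis.Analysis"
    "HOL-Algebra.Exact_Sequence"
    "HOL-Algebra.Generated_Groups"
    "HOL-Algebra.Algebraic_Closure_Type"
    "HOL-Library.Poly_Mapping"
begin

section \<open>The exterior algebra over a commutative ring\<close>

text \<open>
  An element of the exterior algebra on generators \<open>\<theta>\<^sub>i\<close> is stored as the family of its
  coefficients with respect to the products \<open>\<theta>\<^sub>I = \<theta>\<^bsub>i1\<^esub> \<cdots> \<theta>\<^bsub>ik\<^esub>\<close>, where
  \<open>i1 < \<dots> < ik\<close> are the elements of \<open>I\<close>; see \<open>basis_theta_eq_prod\<close> and
  \<open>exterior_expansion\<close> below. Scalars stand on the left and are central.
\<close>

typedef ('n, 'a) exterior = "UNIV :: ('n set \<Rightarrow> 'a) set"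
  morphisms coeff_theta Exterior ..

setup_lifting type_definition_exterior

lemma exterior_eqI: "(\<And>I. coeff_theta \<omega> I = coeff_theta \<eta> I) \<Longrightarrow> \<omega> = \<eta>"
  by transfer (simp add: fun_eq_iff)

text \<open>For disjoint \<open>J\<close> and \<open>K\<close>, \<open>\<theta>\<^sub>J \<theta>\<^sub>K = shuffle_sign J K \<theta>\<^bsub>J \<union> K\<^esub>\<close>.\<close>

definition shuffle_sign :: "'n::linorder set \<Rightarrow> 'n set \<Rightarrow> 'a::ring_1" where
  "shuffle_sign J K = (- 1) ^ card {(j, k) \<in> J \<times> K. k < j}"

lemma shuffle_sign_empty [simp]: "shuffle_sign {} K = 1" "shuffle_sign J {} = 1"
  by (simp_all add: shuffle_sign_def)

lemma shuffle_sign_Un_left: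
  fixes J J' K :: "'n::{finite,linorder} set"
  assumes "J \<inter> J' = {}"
  shows "shuffle_sign (J \<union> J') K = (shuffle_sign J K * shuffle_sign J' K :: 'a::ring_1)"
proof -
  have "{(j, k) \<in> (J \<union> J') \<times> K. k < j} =
    {(j, k) \<in> J \<times> K. k < j} \<union> {(j, k) \<in> J' \<times> K. k < j}" by auto
  moreover have "{(j, k) \<in> J \<times> K. k < j} \<inter> {(j, k) \<in> J' \<times> K. k < j} = {}"
    using assms by auto
  ultimately show ?thesis
    unfolding shuffle_sign_def by (simp add: card_Un_disjoint power_add)
qed

lemma shuffle_sign_Un_right:
  fixes J K K' :: "'n::{finite,linorder} set"
  assumes "K \<inter> K' = {}"
  shows "shuffle_sign J (K \<union> K') = (shuffle_sign J K * shuffle_sign J K' :: 'a::ring_1)"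
proof -
  have "{(j, k) \<in> J \<times> (K \<union> K'). k < j} =
    {(j, k) \<in> J \<times> K. k < j} \<union> {(j, k) \<in> J \<times> K'. k < j}" by auto
  moreover have "{(j, k) \<in> J \<times> K. k < j} \<inter> {(j, k) \<in> J \<times> K'. k < j} = {}"
    using assms by auto
  ultimately show ?thesis
    unfolding shuffle_sign_def by (simp add: card_Un_disjoint power_add)
qed

instantiation exterior :: (type, ab_group_add) ab_group_add
begin

lift_definition zero_exterior :: "('a, 'b) exterior" is "\<lambda>_. 0" .
lift_definition plus_exterior :: "('a, 'b) exterior \<Rightarrow> ('a, 'b) exterior \<Rightarrow> ('a, 'b) exterior"
  is "\<lambda>f g I. f I + g I" .
lift_definition minus_exterior :: "('a, 'b) exterior \<Rightarrow> ('a, 'b) exterior \<Rightarrow> ('a, 'b) exterior"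
  is "\<lambda>f g I. f I - g I" .
lift_definition uminus_exterior :: "('a, 'b) exterior \<Rightarrow> ('a, 'b) exterior"
  is "\<lambda>f I. - f I" .

instance
  by (standard; transfer) (auto simp: fun_eq_iff algebra_simps)

end

instantiation exterior :: ("{finite,linorder}", comm_ring_1) ring_1
begin

lift_definition one_exterior :: "('a, 'b) exterior" is "\<lambda>I. if I = {} then 1 else 0" .
lift_definition times_exterior :: "('a, 'b) exterior \<Rightarrow> ('a, 'b) exterior \<Rightarrow> ('a, 'b) exterior"
  is "\<lambda>f g I. \<Sum>J\<in>Pow I. shuffle_sign J (I - J) * f J * g (I - J)" .

instance
proof
  fix a b c :: "('a, 'b) exterior"
  show "a * b * c = a * (b * c)"
  proof (transfer, rule ext)
    fix f g h :: "'a set \<Rightarrow> 'b" and I :: "'a set"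
    let ?s = "shuffle_sign :: 'a set \<Rightarrow> 'a set \<Rightarrow> 'b"
    have "(\<Sum>J\<in>Pow I. ?s J (I - J) * (\<Sum>L\<in>Pow J. ?s L (J - L) * f L * g (J - L)) * h (I - J))
        = (\<Sum>(J, L)\<in>(SIGMA J:Pow I. Pow J).
             ?s J (I - J) * ?s L (J - L) * f L * g (J - L) * h (I - J))"
      by (simp add: sum.Sigma sum_distrib_left sum_distrib_right mult.assoc)
    also have "\<dots> = (\<Sum>(L, M)\<in>(SIGMA L:Pow I. Pow (I - L)).
             ?s L (I - L) * ?s M (I - L - M) * f L * g M * h (I - L - M))"
    proof (rule sum.reindex_bij_witness
        [where i = "\<lambda>(L, M). (L \<union> M, L)" and j = "\<lambda>(J, L). (L, J - L)"])
      fix p assume "p \<in> (SIGMA J:Pow I. Pow J)"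
      then obtain J L where p: "p = (J, L)" and JL: "J \<subseteq> I" "L \<subseteq> J" by auto
      have 1: "J = L \<union> (J - L)" "I - L = (J - L) \<union> (I - J)" "I - L - (J - L) = I - J"
        using JL by auto
      have 2: "?s J (I - J) = ?s L (I - J) * ?s (J - L) (I - J)"
        using shuffle_sign_Un_left[of L "J - L" "I - J"] 1(1) by auto
      have 3: "?s L (I - L) = ?s L (J - L) * ?s L (I - J)"
        using shuffle_sign_Un_right[of "J - L" "I - J" L] 1(2) by auto
      show "(case case p of (J, L) \<Rightarrow> (L, J - L) of (L, M) \<Rightarrow>
              ?s L (I - L) * ?s M (I - L - M) * f L * g M * h (I - L - M))
          = (case p of (J, L) \<Rightarrow> ?s J (I - J) * ?s L (J - L) * f L * g (J - L) * h (I - J))"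
        unfolding p prod.case 1(3) 2 3 by (simp only: ac_simps)
    qed auto
    also have "\<dots> = (\<Sum>L\<in>Pow I. ?s L (I - L) * f L *
        (\<Sum>M\<in>Pow (I - L). ?s M (I - L - M) * g M * h (I - L - M)))"
      by (simp add: sum.Sigma sum_distrib_left ac_simps)
    finally show "(\<Sum>J\<in>Pow I. ?s J (I - J) * (\<Sum>L\<in>Pow J. ?s L (J - L) * f L * g (J - L)) * h (I - J))
        = (\<Sum>L\<in>Pow I. ?s L (I - L) * f L *
        (\<Sum>M\<in>Pow (I - L). ?s M (I - L - M) * g M * h (I - L - M)))" .
  qed
  show "1 * a = a"
  proof (transfer, rule ext)
    fix f :: "'a set \<Rightarrow> 'b" and I
    have "(\<Sum>J\<in>Pow I. shuffle_sign J (I - J) * (if J = {} then 1 else 0) * f (I - J))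
      = (\<Sum>J\<in>Pow I. if J = {} then f I else 0)"
      by (rule sum.cong) auto
    then show "(\<Sum>J\<in>Pow I. shuffle_sign J (I - J) * (if J = {} then 1 else 0) * f (I - J)) = f I"
      by simp
  qed
  show "a * 1 = a"
  proof (transfer, rule ext)
    fix f :: "'a set \<Rightarrow> 'b" and I
    have "(\<Sum>J\<in>Pow I. shuffle_sign J (I - J) * f J * (if I - J = {} then 1 else 0))
      = (\<Sum>J\<in>Pow I. if J = I then f I else 0)"
      by (rule sum.cong) auto
    then show "(\<Sum>J\<in>Pow I. shuffle_sign J (I - J) * f J * (if I - J = {} then 1 else 0)) = f I"
      by simp
  qed
  show "(a + b) * c = a * c + b * c"
    by transfer (auto simp: fun_eq_iff algebra_simps sum.distrib)
  show "a * (b + c) = a * b + a * c"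
    by transfer (auto simp: fun_eq_iff algebra_simps sum.distrib)
  show "(0 :: ('a, 'b) exterior) \<noteq> 1"
    by transfer (auto simp: fun_eq_iff)
qed

end

lift_definition scalar :: "'a::zero \<Rightarrow> ('n, 'a) exterior" is
  "\<lambda>a I. if I = {} then a else 0" .

lift_definition basis_theta :: "'n set \<Rightarrow> ('n, 'a::zero_neq_one) exterior" is
  "\<lambda>I J. if J = I then 1 else 0" .

abbreviation theta :: "'n \<Rightarrow> ('n, 'a::zero_neq_one) exterior" where
  "theta i \<equiv> basis_theta {i}"

lemma coeff_theta_scalar_times:
  fixes \<omega> :: "('n::{finite,linorder}, 'a::comm_ring_1) exterior"
  shows "coeff_theta (scalar a * \<omega>) I = a * coeff_theta \<omega> I"
proof (transfer fixing: a I)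
  fix f :: "'n set \<Rightarrow> 'a"
  have "(\<Sum>J\<in>Pow I. shuffle_sign J (I - J) * (if J = {} then a else 0) * f (I - J))
      = (\<Sum>J\<in>Pow I. if J = {} then a * f I else 0)"
    by (rule sum.cong) auto
  then show "(\<Sum>J\<in>Pow I. shuffle_sign J (I - J) * (if J = {} then a else 0) * f (I - J)) = a * f I"
    by simp
qed

lemma scalar_central:
  fixes \<omega> :: "('n::{finite,linorder}, 'a::comm_ring_1) exterior"
  shows "\<omega> * scalar a = scalar a * \<omega>"
proof -
  have "coeff_theta (\<omega> * scalar a) I = a * coeff_theta \<omega> I" for I
  proof (transfer fixing: a I)
    fix f :: "'n set \<Rightarrow> 'a"
    have "(\<Sum>J\<in>Pow I. shuffle_sign J (I - J) * f J * (if I - J = {} then a else 0))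
        = (\<Sum>J\<in>Pow I. if J = I then a * f I else 0)"
      by (rule sum.cong) (auto simp: ac_simps)
    then show "(\<Sum>J\<in>Pow I. shuffle_sign J (I - J) * f J * (if I - J = {} then a else 0)) = a * f I"
      by simp
  qed
  then show ?thesis
    by (intro exterior_eqI) (simp add: coeff_theta_scalar_times)
qed

lemma basis_theta_mult:
  fixes J K :: "'n::{finite,linorder} set"
  shows "basis_theta J * basis_theta K =
    (if J \<inter> K = {} then scalar (shuffle_sign J K) * basis_theta (J \<union> K)
     else 0 :: ('n, 'a::comm_ring_1) exterior)"
proof -
  have "coeff_theta (basis_theta J * basis_theta K :: ('n, 'a) exterior) I =
      (if J \<inter> K = {} \<and> I = J \<union> K then shuffle_sign J K else 0)" for I
  proof (transfer fixing: I J K)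
    have "(\<Sum>L\<in>Pow I. shuffle_sign L (I - L) * (if L = J then 1 else 0) * (if I - L = K then 1 else 0))
        = (\<Sum>L\<in>Pow I. if L = J then shuffle_sign J (I - J) * (if I - J = K then 1 else 0) else 0 :: 'a)"
      by (rule sum.cong) auto
    also have "\<dots> = (if J \<subseteq> I \<and> I - J = K then shuffle_sign J (I - J) else 0)"
      by simp
    also have "\<dots> = (if J \<inter> K = {} \<and> I = J \<union> K then shuffle_sign J K else 0)"
      by (cases "J \<subseteq> I \<and> I - J = K") auto
    finally show "(\<Sum>L\<in>Pow I. shuffle_sign L (I - L) * (if L = J then 1 else 0) * (if I - L = K then 1 else 0))
      = (if J \<inter> K = {} \<and> I = J \<union> K then shuffle_sign J K else 0 :: 'a)" .
  qed
  then have "coeff_theta (basis_theta J * basis_theta K :: ('n, 'a) exterior) I =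
     coeff_theta (if J \<inter> K = {} then scalar (shuffle_sign J K) * basis_theta (J \<union> K) else 0) I" for I
    by (auto simp: coeff_theta_scalar_times zero_exterior.rep_eq basis_theta.rep_eq)
  then show ?thesis
    by (rule exterior_eqI)
qed

lemma scalar_hom:
  fixes a b :: "'a::comm_ring_1"
  shows "(scalar 0 :: ('n::{finite,linorder}, 'a) exterior) = 0"
    and "(scalar 1 :: ('n, 'a) exterior) = 1"
    and "(scalar (a + b) :: ('n, 'a) exterior) = scalar a + scalar b"
    and "(scalar (- a) :: ('n, 'a) exterior) = - scalar a"
    and "(scalar (a * b) :: ('n, 'a) exterior) = scalar a * scalar b"
proof -
  show "(scalar (a * b) :: ('n, 'a) exterior) = scalar a * scalar b"
    by (rule exterior_eqI) (simp add: coeff_theta_scalar_times scalar.rep_eq)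
qed (auto intro!: exterior_eqI simp: scalar.rep_eq zero_exterior.rep_eq one_exterior.rep_eq
      plus_exterior.rep_eq uminus_exterior.rep_eq)

lemma theta_square: "theta i * theta i = (0 :: ('n::{finite,linorder}, 'a::comm_ring_1) exterior)"
  by (simp add: basis_theta_mult)

lemma theta_anticommute:
  "theta i * theta j = - (theta j * theta i :: ('n::{finite,linorder}, 'a::comm_ring_1) exterior)"
proof (cases "i = j")
  case False
  have *: "{(j', k'). j' = a \<and> k' = b \<and> k' < j'} = (if b < a then {(a, b)} else {})" for a b :: 'n
    by auto
  show ?thesis
    using False
    by (cases i j rule: linorder_cases)
       (auto simp: basis_theta_mult shuffle_sign_def * scalar_hom insert_commute)
qed (simp add: theta_square)

lemma basis_theta_empty: "basis_theta {} = (1 :: ('n::{finite,linorder}, 'a::comm_ring_1) exterior)"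
  by transfer auto

lemma basis_theta_eq_prod:
  fixes I :: "'n::{finite,linorder} set"
  shows "(basis_theta I :: ('n, 'a::comm_ring_1) exterior) = prod_list (map theta (sorted_list_of_set I))"
proof -
  have "(basis_theta (set xs) :: ('n, 'a) exterior) = prod_list (map theta xs)"
    if "sorted_wrt (<) xs" for xs :: "'n list"
    using that
  proof (induction xs)
    case Nil
    then show ?case by (simp add: basis_theta_empty)
  next
    case (Cons x xs)
    then have less: "\<And>y. y \<in> set xs \<Longrightarrow> x < y" by auto
    then have "{(j, k) \<in> {x} \<times> set xs. k < j} = {}" by fastforce
    then have "shuffle_sign {x} (set xs) = (1 :: 'a)"
      unfolding shuffle_sign_def by (metis card.empty power_0)
    moreover have "x \<notin> set xs" using less by blast
    ultimately have "(theta x * basis_theta (set xs) :: ('n, 'a) exterior) = basis_theta (set (x # xs))"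
      by (simp add: basis_theta_mult scalar_hom)
    with Cons show ?case by simp
  qed
  from this[of "sorted_list_of_set I"] show ?thesis by simp
qed

lemma exterior_expansion:
  fixes \<omega> :: "('n::{finite,linorder}, 'a::comm_ring_1) exterior"
  shows "\<omega> = (\<Sum>I\<in>UNIV. scalar (coeff_theta \<omega> I) * basis_theta I)"
proof -
  have sum: "coeff_theta (\<Sum>I\<in>A. F I) J = (\<Sum>I\<in>A. coeff_theta (F I) J)"
    if "finite A" for A and F :: "'n set \<Rightarrow> ('n, 'a) exterior" and J
    using that by (induction A) (auto simp: zero_exterior.rep_eq plus_exterior.rep_eq)
  have "(\<Sum>I\<in>UNIV. coeff_theta \<omega> I * (if J = I then 1 else 0)) = coeff_theta \<omega> J" for J
    by (simp add: if_distrib[of "(*) _"] cong: if_cong)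
  then show ?thesis
    by (intro exterior_eqI) (simp add: sum coeff_theta_scalar_times basis_theta.rep_eq)
qed


section \<open>Superpolynomials\<close>

text \<open>\<open>K[x\<^sub>1, \<dots>, x\<^sub>n, \<theta>\<^sub>1, \<dots>, \<theta>\<^sub>n]\<close>, with \<open>K\<close> the type \<open>'k\<close> and \<open>n = CARD('n)\<close>.\<close>

type_synonym ('n, 'k) superpoly = "('n, ('n \<Rightarrow>\<^sub>0 nat) \<Rightarrow>\<^sub>0 'k) exterior"

definition const :: "'k::zero \<Rightarrow> ('n, 'k) superpoly" where
  "const c = scalar (Poly_Mapping.single 0 c)"

definition xvar :: "'n \<Rightarrow> ('n, 'k::zero_neq_one) superpoly" where
  "xvar i = scalar (Poly_Mapping.single (Poly_Mapping.single i 1) 1)"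

definition coeff :: "('n, 'k::zero) superpoly \<Rightarrow> ('n \<Rightarrow>\<^sub>0 nat) \<Rightarrow> 'n set \<Rightarrow> 'k" where
  "coeff \<omega> \<alpha> I = Poly_Mapping.lookup (coeff_theta \<omega> I) \<alpha>"

text \<open>The pairs \<open>(\<alpha>, I)\<close> for which \<open>x\<^sup>\<alpha> \<theta>\<^sub>I\<close> occurs in \<open>\<omega>\<close>; a finite set when \<open>'n\<close> is finite.\<close>

definition supp :: "('n, 'k::zero) superpoly \<Rightarrow> (('n \<Rightarrow>\<^sub>0 nat) \<times> 'n set) set" where
  "supp \<omega> = {(\<alpha>, I). coeff \<omega> \<alpha> I \<noteq> 0}"

lemma finite_supp: "finite (supp (\<omega> :: ('n::finite, 'k::zero) superpoly))"
proof -
  have "supp \<omega> \<subseteq> (\<Union>I. Poly_Mapping.keys (coeff_theta \<omega> I) \<times> {I})"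
    by (auto simp: supp_def coeff_def in_keys_iff)
  then show ?thesis by (rule finite_subset) auto
qed

definition xdegree :: "('n::finite \<Rightarrow>\<^sub>0 nat) \<Rightarrow> nat" where
  "xdegree \<alpha> = (\<Sum>i\<in>UNIV. Poly_Mapping.lookup \<alpha> i)"

definition bihomogeneous :: "nat \<Rightarrow> nat \<Rightarrow> ('n::finite, 'k::zero) superpoly \<Rightarrow> bool" where
  "bihomogeneous a b \<omega> \<longleftrightarrow> (\<forall>(\<alpha>, I)\<in>supp \<omega>. xdegree \<alpha> = a \<and> card I = b)"

definition poly_pderiv :: "'n \<Rightarrow> (('n \<Rightarrow>\<^sub>0 nat) \<Rightarrow>\<^sub>0 'k::comm_ring_1) \<Rightarrow> (('n \<Rightarrow>\<^sub>0 nat) \<Rightarrow>\<^sub>0 'k)" where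
  "poly_pderiv i p = (\<Sum>\<alpha>\<in>Poly_Mapping.keys p.
     Poly_Mapping.single (\<alpha> - Poly_Mapping.single i 1)
       (of_nat (Poly_Mapping.lookup \<alpha> i) * Poly_Mapping.lookup p \<alpha>))"

definition deriv_x :: "'n \<Rightarrow> ('n, 'k::comm_ring_1) superpoly \<Rightarrow> ('n, 'k) superpoly" where
  "deriv_x i \<omega> = Exterior (\<lambda>I. poly_pderiv i (coeff_theta \<omega> I))"

text \<open>
  The interior product sends \<open>\<theta>\<^sub>J\<close> with \<open>i \<in> J\<close> to \<open>\<theta>\<^bsub>J - {i}\<^esub>\<close> with sign
  \<open>(-1)\<^sup>m\<close>, where \<open>m\<close> is the number of elements of \<open>J\<close> below \<open>i\<close>; below, \<open>J = insert i I\<close>.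
\<close>

definition deriv_theta :: "'n::linorder \<Rightarrow> ('n, 'k::comm_ring_1) superpoly \<Rightarrow> ('n, 'k) superpoly" where
  "deriv_theta i \<omega> = Exterior (\<lambda>I. if i \<in> I then 0
     else (- 1) ^ card {j \<in> I. j < i} * coeff_theta \<omega> (insert i I))"

definition ext_d :: "('n::{finite,linorder}, 'k::comm_ring_1) superpoly \<Rightarrow> ('n, 'k) superpoly" where
  "ext_d \<omega> = (\<Sum>i\<in>UNIV. deriv_x i (theta i * \<omega>))"


section \<open>The field, and pseudo-reflection groups\<close>

text \<open>
  The subfield \<open>K\<close> of the complex numbers is the image of a field type \<open>'k\<close> under \<open>\<iota>\<close>.
\<close>

definition conj_closed_embedding :: "('k::field \<Rightarrow> complex) \<Rightarrow> bool" where
  "conj_closed_embedding \<iota> \<longleftrightarrow>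
     \<iota> 1 = 1 \<and> (\<forall>a b. \<iota> (a + b) = \<iota> a + \<iota> b) \<and> (\<forall>a b. \<iota> (a * b) = \<iota> a * \<iota> b) \<and>
     (\<forall>z\<in>range \<iota>. cnj z \<in> range \<iota>)"

definition conj_of :: "('k::field \<Rightarrow> complex) \<Rightarrow> 'k \<Rightarrow> 'k" where
  "conj_of \<iota> a = (THE b. \<iota> b = cnj (\<iota> a))"

lemma emb_conj_of:
  assumes "conj_closed_embedding \<iota>"
  shows "\<iota> (conj_of \<iota> a) = cnj (\<iota> a)"
proof -
  have add: "\<And>a b. \<iota> (a + b) = \<iota> a + \<iota> b" and mult: "\<And>a b. \<iota> (a * b) = \<iota> a * \<iota> b"
    and one: "\<iota> 1 = 1" and closed: "\<And>a. cnj (\<iota> a) \<in> range \<iota>"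
    using assms by (auto simp: conj_closed_embedding_def)
  have zero: "\<iota> 0 = 0" using add[of 0 0] by simp
  have diff: "\<iota> (a - b) = \<iota> a - \<iota> b" for a b
    using add[of "a - b" b] by simp
  have "b = c" if "\<iota> b = \<iota> c" for b c
  proof (rule ccontr)
    assume "b \<noteq> c"
    then have "\<iota> (b - c) * \<iota> (inverse (b - c)) = 1"
      by (simp flip: mult add: one)
    then show False using that diff by simp
  qed
  moreover obtain b where "\<iota> b = cnj (\<iota> a)" using closed[of a] by force
  ultimately show ?thesis
    unfolding conj_of_def by (intro theI[of "\<lambda>b. \<iota> b = cnj (\<iota> a)" b]) auto
qed

text \<open>Written without \<open>^\<close> because that notation fixes the sort of \<open>'n\<close> to \<open>finite\<close>.\<close>

type_synonym ('k, 'n) square_matrix = "(('k, 'n) vec, 'n) vec"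

definition GL :: "('k::field ^ 'n ^ 'n) monoid" where
  "GL = \<lparr>carrier = {A. invertible A}, mult = (**), one = mat 1\<rparr>"

lemma group_GL: "group (GL :: ('k::field ^ 'n ^ 'n) monoid)"
proof (rule groupI)
  fix A :: "'k ^ 'n ^ 'n" assume "A \<in> carrier GL"
  then obtain B where B: "A ** B = mat 1" "B ** A = mat 1"
    by (auto simp: GL_def invertible_def)
  then show "\<exists>y\<in>carrier GL. y \<otimes>\<^bsub>GL\<^esub> A = \<one>\<^bsub>GL\<^esub>"
    by (auto simp: GL_def invertible_def intro!: bexI[of _ B])
qed (auto simp: GL_def invertible_mult matrix_mul_assoc invertible_def[of "mat 1"])

definition unitary :: "('k::field \<Rightarrow> complex) \<Rightarrow> 'k ^ 'n ^ 'n \<Rightarrow> bool" where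
  "unitary \<iota> A \<longleftrightarrow>
     A ** (\<chi> i j. conj_of \<iota> (A $ j $ i)) = mat 1 \<and> (\<chi> i j. conj_of \<iota> (A $ j $ i)) ** A = mat 1"

definition pseudo_reflection :: "'k::field ^ 'n ^ 'n \<Rightarrow> bool" where
  "pseudo_reflection A \<longleftrightarrow> A \<in> carrier GL \<and> A \<noteq> mat 1 \<and>
     (\<exists>m>0. A [^]\<^bsub>GL\<^esub> (m::nat) = mat 1) \<and>
     (\<exists>H. vec.subspace H \<and> vec.dim H + 1 = CARD('n) \<and> (\<forall>v\<in>H. A *v v = v))"

definition pseudo_reflection_group :: "('k::field \<Rightarrow> complex) \<Rightarrow> ('k ^ 'n ^ 'n) set \<Rightarrow> bool" where
  "pseudo_reflection_group \<iota> G \<longleftrightarrow> finite G \<and> (\<forall>A\<in>G. unitary \<iota> A) \<and>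
     (\<exists>S. (\<forall>A\<in>S. pseudo_reflection A) \<and> G = generate GL S)"

definition fixed_space :: "('k::field ^ 'n ^ 'n) set \<Rightarrow> ('k ^ 'n) set" where
  "fixed_space G = {v. \<forall>A\<in>G. A *v v = v}"

text \<open>\<open>dim (V/W) = dim V - dim W\<close> for a subspace \<open>W\<close> of \<open>V = K\<^sup>n\<close>, so nothing is truncated.\<close>

definition quotient_dim :: "('k::field ^ 'n) set \<Rightarrow> nat" where
  "quotient_dim W = vec.dim (UNIV :: ('k ^ 'n) set) - vec.dim W"


section \<open>Super harmonics\<close>

definition act_x :: "('k::field \<Rightarrow> complex) \<Rightarrow> ('k, 'n) square_matrix \<Rightarrow> 'n \<Rightarrow> ('n::{finite,linorder}, 'k) superpoly" where
  "act_x \<iota> A j = (\<Sum>i\<in>UNIV. const (conj_of \<iota> (A $ i $ j)) * xvar i)"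

definition act_theta :: "('k::field \<Rightarrow> complex) \<Rightarrow> ('k, 'n) square_matrix \<Rightarrow> 'n \<Rightarrow> ('n::{finite,linorder}, 'k) superpoly" where
  "act_theta \<iota> A j = (\<Sum>i\<in>UNIV. const (conj_of \<iota> (A $ i $ j)) * theta i)"

text \<open>
  The algebra endomorphism with \<open>x\<^sub>j \<mapsto> act_x \<iota> A j\<close> and \<open>\<theta>\<^sub>j \<mapsto> act_theta \<iota> A j\<close>,
  obtained by substituting in every monomial \<open>x\<^sup>\<alpha> \<theta>\<^sub>I\<close>; the order of the factors matters
  only for the \<open>\<theta>\<close> part.
\<close>

definition act :: "('k::field \<Rightarrow> complex) \<Rightarrow> ('k, 'n) square_matrix \<Rightarrow>
    ('n::{finite,linorder}, 'k) superpoly \<Rightarrow> ('n, 'k) superpoly" where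
  "act \<iota> A \<omega> = (\<Sum>(\<alpha>, I)\<in>supp \<omega>. const (coeff \<omega> \<alpha> I) *
     prod_list (map (\<lambda>j. act_x \<iota> A j ^ Poly_Mapping.lookup \<alpha> j) (sorted_list_of_set UNIV)) *
     prod_list (map (act_theta \<iota> A) (sorted_list_of_set I)))"

text \<open>
  \<open>fold\<close> applies the operator of the first list element first, so for
  \<open>I = {i1 < \<dots> < ik}\<close> the \<open>\<theta>\<close> part is the composition with \<open>\<partial>\<^bsub>\<theta>i1\<^esub>\<close>
  innermost and \<open>\<partial>\<^bsub>\<theta>ik\<^esub>\<close> outermost.
\<close>

definition diff_op :: "('k::field \<Rightarrow> complex) \<Rightarrow> ('n::{finite,linorder}, 'k) superpoly \<Rightarrow>
    ('n, 'k) superpoly \<Rightarrow> ('n, 'k) superpoly" where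
  "diff_op \<iota> \<omega> \<eta> = (\<Sum>(\<alpha>, I)\<in>supp \<omega>. const (conj_of \<iota> (coeff \<omega> \<alpha> I)) *
     fold (\<lambda>i. deriv_x i ^^ Poly_Mapping.lookup \<alpha> i) (sorted_list_of_set UNIV)
       (fold deriv_theta (sorted_list_of_set I) \<eta>))"

definition invariant_ideal :: "('k::field \<Rightarrow> complex) \<Rightarrow> ('k, 'n) square_matrix set \<Rightarrow>
    ('n::{finite,linorder}, 'k) superpoly set" where
  "invariant_ideal \<iota> G = Idl\<^bsub>ring_of_type_algebra\<^esub>
     {\<omega>. (\<exists>a b. a + b > 0 \<and> bihomogeneous a b \<omega>) \<and> (\<forall>A\<in>G. act \<iota> A \<omega> = \<omega>)}"

definition super_harmonics :: "('k::field \<Rightarrow> complex) \<Rightarrow> ('k, 'n) square_matrix set \<Rightarrow>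
    ('n::{finite,linorder}, 'k) superpoly set" where
  "super_harmonics \<iota> G = {\<eta>. \<forall>\<omega>\<in>invariant_ideal \<iota> G. diff_op \<iota> \<omega> \<eta> = 0}"

definition SH :: "('k::field \<Rightarrow> complex) \<Rightarrow> ('k, 'n) square_matrix set \<Rightarrow> nat \<Rightarrow>
    ('n::{finite,linorder}, 'k) superpoly set" where
  "SH \<iota> G k = {\<eta>\<in>super_harmonics \<iota> G. \<forall>(\<alpha>, I)\<in>supp \<eta>. card I = k}"

definition additive_group :: "'a::ab_group_add set \<Rightarrow> 'a monoid" where
  "additive_group M = \<lparr>carrier = M, mult = (+), one = 0\<rparr>"

end

theory Submission
  imports Defs
begin

text \<open>
  The proof is a Poincare lemma. Let \<open>\<delta> = \<Sum>\<^sub>i x\<^sub>i \<partial>\<^bsub>\<theta>i\<^esub>\<close> be the contraction with the Euler vector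
  field (\<open>euler_contraction\<close>). By Cartan's formula, \<open>E = d \<delta> + \<delta> d\<close> multiplies
  \<open>x\<^sup>\<alpha> \<theta>\<^sub>I\<close> by its total degree \<open>|\<alpha>| + |I|\<close> (\<open>cartan_formula\<close>), which is non-zero in
  characteristic zero except on constants. So a closed form \<open>\<eta>\<close> of positive \<open>\<theta>\<close>-degree is
  \<open>d (\<delta> \<zeta>)\<close> for \<open>\<zeta>\<close> with \<open>E \<zeta> = \<eta>\<close> and \<open>d \<zeta> = 0\<close>. What has to be shown is that
  this argument takes place inside the super harmonics.

  Both \<open>d\<close> and \<open>\<delta>\<close> are antiderivations that commute with linear substitutions and
  preserve the total degree, so they send the generators of the ideal of invariants to generators and
  preserve the ideal (\<open>invariant_ideal_stable\<close>). With respect to \<open>\<omega> \<mapsto> \<partial>\<^sub>\<omega>\<close> they are adjoint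
  to each other: if \<open>\<omega>'\<close> is \<open>\<omega>\<close> with its part of odd \<open>\<theta>\<close>-degree negated, then
  \<open>\<partial>\<^sub>\<omega> d = \<partial>\<^bsub>\<delta>\<omega>\<^esub> + d \<partial>\<^bsub>\<omega>'\<^esub>\<close> and \<open>\<partial>\<^sub>\<omega> \<delta> = \<partial>\<^bsub>d\<omega>\<^esub> + \<delta> \<partial>\<^bsub>\<omega>'\<^esub>\<close>
  (\<open>diff_op_ext_d\<close>, \<open>diff_op_euler_contraction\<close>). Applied to a super harmonic form with
  \<open>\<omega>\<close> in the ideal, the right-hand sides vanish. Hence \<open>d\<close>, \<open>\<delta>\<close> and \<open>E\<close> act on the
  super harmonics. A linear space that is stable under the diagonal operator \<open>E\<close> also contains a
  solution of \<open>E \<zeta> = \<eta>\<close> for each of its elements \<open>\<eta>\<close> without constant term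
  (\<open>degree_operator_surj\<close>).

  The complex stops at \<open>r = dim (V/V\<^sup>G)\<close> because there are no super harmonics of \<open>\<theta>\<close>-degree
  \<open>k > r\<close> (\<open>SH_above_top\<close>): each \<open>v \<in> V\<^sup>G\<close> gives an invariant linear form in the
  \<open>\<theta>\<^sub>j\<close>, so contraction with \<open>v\<close> kills the super harmonics, and a coordinate subspace of
  dimension \<open>k > r\<close> contains a non-zero vector of \<open>V\<^sup>G\<close>. The exact sequence is therefore the
  one for all \<open>\<theta>\<close>-degrees, cut where it has become zero.
\<close>

section \<open>Coefficients of products and derivatives\<close>

lemma superpoly_eqI:
  "(\<And>\<alpha> I. coeff \<omega> \<alpha> I = coeff \<eta> \<alpha> I) \<Longrightarrow> \<omega> = \<eta>"
  by (auto simp: coeff_def intro!: exterior_eqI poly_mapping_eqI)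

lemma coeff_zero [simp]: "coeff 0 \<alpha> I = 0"
  by (simp add: coeff_def zero_exterior.rep_eq)

lemma coeff_add [simp]: "coeff (\<omega> + \<eta>) \<alpha> I = coeff \<omega> \<alpha> I + coeff \<eta> \<alpha> I"
  by (simp add: coeff_def plus_exterior.rep_eq lookup_add)

lemma coeff_uminus [simp]: "coeff (- \<omega>) \<alpha> I = - coeff \<omega> \<alpha> I"
  by (simp add: coeff_def uminus_exterior.rep_eq)

lemma coeff_diff [simp]: "coeff (\<omega> - \<eta>) \<alpha> I = coeff \<omega> \<alpha> I - coeff \<eta> \<alpha> I"
  by (simp add: coeff_def minus_exterior.rep_eq lookup_minus)

lemma coeff_sum [simp]: "coeff (\<Sum>i\<in>A. f i) \<alpha> I = (\<Sum>i\<in>A. coeff (f i) \<alpha> I)"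
  by (induction A rule: infinite_finite_induct) auto

lemma lookup_single_mult:
  fixes p :: "('a::cancel_comm_monoid_add) \<Rightarrow>\<^sub>0 'k::comm_semiring_1"
  shows "Poly_Mapping.lookup (Poly_Mapping.single \<beta> c * p) (\<beta> + \<gamma>) = c * Poly_Mapping.lookup p \<gamma>"
proof -
  have "(\<Sum>l. Poly_Mapping.lookup (Poly_Mapping.single \<beta> c) l *
            (\<Sum>q. Poly_Mapping.lookup p q when \<beta> + \<gamma> = l + q))
      = (\<Sum>l. c * Poly_Mapping.lookup p \<gamma> when l = \<beta>)"
    by (rule Sum_any.cong) (auto simp: lookup_single when_def)
  then show ?thesis
    by (simp add: lookup_mult)
qed

lemma coeff_const [simp]: "coeff (const c) \<alpha> I = (if \<alpha> = 0 \<and> I = {} then c else 0)"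
  by (auto simp: coeff_def const_def scalar.rep_eq lookup_single when_def)

lemma coeff_const_times [simp]:
  fixes \<omega> :: "('n::{finite,linorder}, 'k::comm_ring_1) superpoly"
  shows "coeff (const c * \<omega>) \<alpha> I = c * coeff \<omega> \<alpha> I"
  using lookup_single_mult[of 0 c "coeff_theta \<omega> I" \<alpha>]
  by (simp add: coeff_def const_def coeff_theta_scalar_times)

lemma shift_exponent:
  assumes "Poly_Mapping.lookup \<alpha> i \<noteq> (0::nat)"
  shows "Poly_Mapping.single i 1 + (\<alpha> - Poly_Mapping.single i 1) = \<alpha>"
  using assms by (intro poly_mapping_eqI) (auto simp: lookup_add lookup_minus lookup_single when_def)

lemma coeff_xvar_times [simp]:
  fixes \<omega> :: "('n::{finite,linorder}, 'k::comm_ring_1) superpoly"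
  shows "coeff (xvar i * \<omega>) \<alpha> I =
    (if Poly_Mapping.lookup \<alpha> i = 0 then 0 else coeff \<omega> (\<alpha> - Poly_Mapping.single i 1) I)"
proof (cases "Poly_Mapping.lookup \<alpha> i = 0")
  case True
  let ?p = "Poly_Mapping.single (Poly_Mapping.single i 1) 1 * coeff_theta \<omega> I"
  have "\<alpha> \<notin> Poly_Mapping.keys ?p"
  proof
    assume "\<alpha> \<in> Poly_Mapping.keys ?p"
    then have "\<alpha> \<in> {a + b |a b. a \<in> Poly_Mapping.keys (Poly_Mapping.single (Poly_Mapping.single i (1::nat)) (1::'k)) \<and>
        b \<in> Poly_Mapping.keys (coeff_theta \<omega> I)}"
      using keys_mult by blast
    then obtain b where "\<alpha> = Poly_Mapping.single i 1 + b"
      by auto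
    with True show False by (simp add: lookup_add)
  qed
  with True show ?thesis
    by (simp add: coeff_def xvar_def coeff_theta_scalar_times in_keys_iff)
next
  case False
  then show ?thesis
    using lookup_single_mult[of "Poly_Mapping.single i 1" 1 "coeff_theta \<omega> I" "\<alpha> - Poly_Mapping.single i 1"]
    by (simp add: coeff_def xvar_def coeff_theta_scalar_times shift_exponent[OF False, simplified])
qed

definition sign_below :: "'n::linorder \<Rightarrow> 'n set \<Rightarrow> 'k::ring_1" where
  "sign_below i I = (- 1) ^ card {j \<in> I. j < i}"

lemma sign_below_square [simp]:
  "sign_below i I * (sign_below i I * c) = (c :: 'k::ring_1)"
  "sign_below i I * sign_below i I = (1 :: 'k::ring_1)"
  by (simp_all add: sign_below_def flip: mult.assoc power_add)

lemma sign_below_insert: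
  fixes I :: "'n::{finite,linorder} set"
  shows "sign_below i (insert j I) =
    (if j < i \<and> j \<notin> I then - sign_below i I else (sign_below i I :: 'k::ring_1))"
proof (cases "j < i \<and> j \<notin> I")
  case True
  then have "{k \<in> insert j I. k < i} = insert j {k \<in> I. k < i}" by auto
  with True show ?thesis by (simp add: sign_below_def)
next
  case False
  then have "{k \<in> insert j I. k < i} = {k \<in> I. k < i}" by auto
  then show ?thesis unfolding sign_below_def using False by (simp only: if_False)
qed

lemma sign_below_remove:
  fixes I :: "'n::{finite,linorder} set"
  shows "sign_below i (I - {j}) =
    (if j < i \<and> j \<in> I then - sign_below i I else (sign_below i I :: 'k::ring_1))"
proof (cases "j \<in> I")
  case True
  then show ?thesis
    using sign_below_insert[of i j "I - {j}", where 'k='k] by (auto simp: insert_absorb)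
qed simp

lemma coeff_theta_times [simp]:
  fixes \<omega> :: "('n::{finite,linorder}, 'k::comm_ring_1) superpoly"
  shows "coeff (theta i * \<omega>) \<alpha> I =
    (if i \<in> I then sign_below i I * coeff \<omega> \<alpha> (I - {i}) else 0)"
proof -
  have sign: "shuffle_sign {i} (I - {i}) = (sign_below i I :: ('n \<Rightarrow>\<^sub>0 nat) \<Rightarrow>\<^sub>0 'k)"
  proof -
    have "{(j, k) \<in> {i} \<times> (I - {i}). k < j} = Pair i ` {k \<in> I. k < i}" by auto
    then show ?thesis
      by (simp add: shuffle_sign_def sign_below_def card_image inj_on_def)
  qed
  have lookup: "Poly_Mapping.lookup (sign_below i I * p) \<alpha> = sign_below i I * Poly_Mapping.lookup p \<alpha>"
    for p :: "('n \<Rightarrow>\<^sub>0 nat) \<Rightarrow>\<^sub>0 'k"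
    unfolding sign_below_def by (induction "card {j \<in> I. j < i}" arbitrary: i) (auto simp: minus_one_power_iff)
  have "coeff_theta (theta i * \<omega>) I =
      (\<Sum>J\<in>Pow I. if J = {i} then shuffle_sign {i} (I - {i}) * coeff_theta \<omega> (I - {i}) else 0)"
    unfolding times_exterior.rep_eq by (rule sum.cong) (auto simp: basis_theta.rep_eq)
  also have "\<dots> = (if i \<in> I then sign_below i I * coeff_theta \<omega> (I - {i}) else 0)"
    by (simp add: sign)
  finally show ?thesis
    by (simp add: coeff_def lookup)
qed

lemma coeff_deriv_theta [simp]:
  fixes \<omega> :: "('n::{finite,linorder}, 'k::comm_ring_1) superpoly"
  shows "coeff (deriv_theta i \<omega>) \<alpha> I =
    (if i \<in> I then 0 else sign_below i I * coeff \<omega> \<alpha> (insert i I))"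
  by (auto simp: coeff_def deriv_theta_def Exterior_inverse sign_below_def minus_one_power_iff)

lemma coeff_deriv_x [simp]:
  fixes \<omega> :: "('n::{finite,linorder}, 'k::comm_ring_1) superpoly"
  shows "coeff (deriv_x i \<omega>) \<alpha> I =
    of_nat (Poly_Mapping.lookup \<alpha> i + 1) * coeff \<omega> (\<alpha> + Poly_Mapping.single i 1) I"
proof -
  let ?e = "Poly_Mapping.single i (1::nat)" and ?p = "coeff_theta \<omega> I"
  have shift: "(of_nat (Poly_Mapping.lookup \<beta> i) * c when \<beta> - ?e = \<alpha>) =
      (if \<beta> = \<alpha> + ?e then of_nat (Poly_Mapping.lookup \<beta> i) * c else (0::'k))" for \<beta> c
  proof (cases "Poly_Mapping.lookup \<beta> i = 0")
    case True
    then have "\<beta> \<noteq> \<alpha> + ?e" by (auto simp: lookup_add)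
    with True show ?thesis by (simp add: when_def)
  next
    case False
    then have "\<beta> - ?e = \<alpha> \<longleftrightarrow> \<beta> = \<alpha> + ?e"
      using shift_exponent[OF False] by (auto simp: add.commute)
    then show ?thesis by (simp add: when_def)
  qed
  show ?thesis
    by (auto simp: coeff_def deriv_x_def Exterior_inverse poly_pderiv_def lookup_sum lookup_single
        shift in_keys_iff lookup_add simp del: One_nat_def)
qed

section \<open>Generators\<close>

lemma const_hom:
  fixes a b :: "'k::comm_ring_1"
  shows "(const 0 :: ('n::{finite,linorder}, 'k) superpoly) = 0"
    and "(const 1 :: ('n, 'k) superpoly) = 1"
    and "(const (a + b) :: ('n, 'k) superpoly) = const a + const b"
    and "(const (a * b) :: ('n, 'k) superpoly) = const a * const b"
    and "(const (- a) :: ('n, 'k) superpoly) = - const a"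
proof -
  show "(const 1 :: ('n, 'k) superpoly) = 1"
    by (simp add: const_def scalar_hom single_one)
qed (rule superpoly_eqI, simp add: algebra_simps)+

lemma const_commute:
  "\<omega> * const c = const c * (\<omega> :: ('n::{finite,linorder}, 'k::comm_ring_1) superpoly)"
  by (simp add: const_def scalar_central)

lemma const_left_commute:
  fixes \<omega> \<eta> :: "('n::{finite,linorder}, 'k::comm_ring_1) superpoly"
  shows "\<omega> * (const c * \<eta>) = const c * (\<omega> * \<eta>)"
  unfolding mult.assoc[symmetric] const_commute[of \<omega> c] ..

lemma const_const_times:
  fixes \<omega> :: "('n::{finite,linorder}, 'k::comm_ring_1) superpoly"
  shows "const a * (const b * \<omega>) = const (a * b) * \<omega>"
  by (simp add: const_hom mult.assoc)

lemma xvar_commute: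
  "\<omega> * xvar i = xvar i * (\<omega> :: ('n::{finite,linorder}, 'k::comm_ring_1) superpoly)"
  by (simp add: xvar_def scalar_central)

lemma xvar_left_commute:
  fixes \<omega> \<eta> :: "('n::{finite,linorder}, 'k::comm_ring_1) superpoly"
  shows "\<omega> * (xvar i * \<eta>) = xvar i * (\<omega> * \<eta>)"
  unfolding mult.assoc[symmetric] xvar_commute[of \<omega> i] ..

lemma xdegree_eq_0_iff: "xdegree \<alpha> = 0 \<longleftrightarrow> \<alpha> = 0"
  by (simp add: xdegree_def poly_mapping_eq_iff fun_eq_iff)

lemma xdegree_add_single: "xdegree (\<alpha> + Poly_Mapping.single i 1) = Suc (xdegree \<alpha>)"
  by (simp add: xdegree_def lookup_add sum.distrib lookup_single when_def)

lemma xdegree_minus_single: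
  assumes "Poly_Mapping.lookup \<alpha> i \<noteq> 0"
  shows "Suc (xdegree (\<alpha> - Poly_Mapping.single i 1)) = xdegree \<alpha>"
  using xdegree_add_single[of "\<alpha> - Poly_Mapping.single i 1" i] shift_exponent[OF assms]
  by (simp add: add.commute)

text \<open>
  Superpolynomials are generated by left multiplication with the variables. Identities between
  operators whose commutators with the variables are known are all proved by this rule. A monomial is
  built by splitting off any variable that divides it, at the cost of a sign for a \<open>\<theta>\<^sub>i\<close>.
\<close>

lemma superpoly_induct [case_names const add xvar theta]:
  fixes \<omega> :: "('n::{finite,linorder}, 'k::comm_ring_1) superpoly"
  assumes const: "\<And>c. P (const c)"
    and add: "\<And>\<omega> \<eta>. P \<omega> \<Longrightarrow> P \<eta> \<Longrightarrow> P (\<omega> + \<eta>)"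
    and xvar: "\<And>i \<omega>. P \<omega> \<Longrightarrow> P (xvar i * \<omega>)"
    and theta: "\<And>i \<omega>. P \<omega> \<Longrightarrow> P (theta i * \<omega>)"
  shows "P \<omega>"
proof -
  define mono where "mono c \<alpha> I = (Exterior (\<lambda>J. if J = I then Poly_Mapping.single \<alpha> c else 0) ::
      ('n, 'k) superpoly)" for c \<alpha> I
  have coeff_mono: "coeff (mono c \<alpha> I) \<beta> J = (if \<beta> = \<alpha> \<and> J = I then c else 0)" for c \<alpha> I \<beta> J
    by (auto simp: mono_def coeff_def Exterior_inverse lookup_single when_def)
  have mono: "P (mono c \<alpha> I)" for c \<alpha> I
  proof (induction "xdegree \<alpha> + card I" arbitrary: c \<alpha> I)
    case 0
    then have "\<alpha> = 0" "I = {}" by (simp_all add: xdegree_eq_0_iff)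
    then have "mono c \<alpha> I = const c"
      by (intro superpoly_eqI) (simp add: coeff_mono)
    with const show ?case by simp
  next
    case (Suc m)
    show ?case
    proof (cases "I = {}")
      case True
      with Suc have "xdegree \<alpha> \<noteq> 0" by auto
      then obtain i where i: "Poly_Mapping.lookup \<alpha> i \<noteq> 0" by (auto simp: xdegree_def)
      have "\<beta> - Poly_Mapping.single i 1 = \<alpha> - Poly_Mapping.single i 1 \<longleftrightarrow> \<beta> = \<alpha>"
        if "Poly_Mapping.lookup \<beta> i \<noteq> 0" for \<beta>
        using shift_exponent[OF i] shift_exponent[OF that] by metis
      then have "mono c \<alpha> I = xvar i * mono c (\<alpha> - Poly_Mapping.single i 1) I"
        using i by (intro superpoly_eqI) (auto simp: coeff_mono)
      moreover have "P (mono c (\<alpha> - Poly_Mapping.single i 1) I)"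
        using Suc xdegree_minus_single[OF i] by auto
      ultimately show ?thesis using xvar by simp
    next
      case False
      then obtain i where i: "i \<in> I" by blast
      have "mono c \<alpha> I = theta i * mono (sign_below i I * c) \<alpha> (I - {i})"
        using i by (intro superpoly_eqI) (auto simp: coeff_mono)
      moreover have "P (mono (sign_below i I * c) \<alpha> (I - {i}))"
        using i Suc(2) card_Suc_Diff1[of I i] by (intro Suc(1)) simp
      ultimately show ?thesis using theta by simp
    qed
  qed
  have "P (\<Sum>(\<alpha>, I)\<in>A. mono (coeff \<omega> \<alpha> I) \<alpha> I)" if "finite A" for A
    using that
  proof induction
    case empty
    then show ?case using const[of 0] by (simp add: const_hom)
  next
    case (insert x F)
    then show ?case by (cases x) (auto intro!: add mono)
  qed
  from this[OF finite_supp[of \<omega>]] have "P (\<Sum>(\<alpha>, I)\<in>supp \<omega>. mono (coeff \<omega> \<alpha> I) \<alpha> I)" .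
  also have "(\<Sum>(\<alpha>, I)\<in>supp \<omega>. mono (coeff \<omega> \<alpha> I) \<alpha> I) = \<omega>"
  proof (rule superpoly_eqI)
    fix \<beta> J
    have "coeff (\<Sum>(\<alpha>, I)\<in>supp \<omega>. mono (coeff \<omega> \<alpha> I) \<alpha> I) \<beta> J =
       (\<Sum>p\<in>supp \<omega>. if p = (\<beta>, J) then coeff \<omega> \<beta> J else 0)"
      unfolding coeff_sum by (rule sum.cong) (auto simp: coeff_mono split: if_splits)
    also have "\<dots> = coeff \<omega> \<beta> J"
      using finite_supp[of \<omega>] by (simp add: supp_def)
    finally show "coeff (\<Sum>(\<alpha>, I)\<in>supp \<omega>. mono (coeff \<omega> \<alpha> I) \<alpha> I) \<beta> J = coeff \<omega> \<beta> J" .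
  qed
  finally show ?thesis .
qed

section \<open>The exterior derivative and the Euler contraction\<close>

lemma deriv_linear:
  fixes \<omega> \<eta> :: "('n::{finite,linorder}, 'k::comm_ring_1) superpoly"
  shows "deriv_x i (\<omega> + \<eta>) = deriv_x i \<omega> + deriv_x i \<eta>"
    and "deriv_x i (const c * \<omega>) = const c * deriv_x i \<omega>"
    and "deriv_theta i (\<omega> + \<eta>) = deriv_theta i \<omega> + deriv_theta i \<eta>"
    and "deriv_theta i (const c * \<omega>) = const c * deriv_theta i \<omega>"
  by (rule superpoly_eqI, simp add: algebra_simps)+

lemma deriv_const:
  shows "deriv_x i (const c :: ('n::{finite,linorder}, 'k::comm_ring_1) superpoly) = 0"
    and "deriv_theta i (const c :: ('n::{finite,linorder}, 'k::comm_ring_1) superpoly) = 0"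
proof -
  have "\<alpha> + Poly_Mapping.single i 1 \<noteq> 0" for \<alpha> :: "'n \<Rightarrow>\<^sub>0 nat"
    using xdegree_add_single[of \<alpha> i] xdegree_eq_0_iff[of "\<alpha> + Poly_Mapping.single i 1"] by auto
  then show "deriv_x i (const c :: ('n, 'k) superpoly) = 0"
    by (intro superpoly_eqI) (simp del: One_nat_def)
qed (rule superpoly_eqI, simp)

lemma deriv_x_xvar_times:
  fixes \<omega> :: "('n::{finite,linorder}, 'k::comm_ring_1) superpoly"
  shows "deriv_x i (xvar j * \<omega>) = (if i = j then \<omega> else 0) + xvar j * deriv_x i \<omega>"
proof (rule superpoly_eqI)
  fix \<alpha> I
  let ?e = "\<lambda>i. Poly_Mapping.single i (1::nat)"
  have 1: "\<alpha> - ?e j + ?e i = \<alpha> + ?e i - ?e j" if "Poly_Mapping.lookup \<alpha> j \<noteq> 0"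
    using that by (intro poly_mapping_eqI) (auto simp: lookup_add lookup_minus lookup_single when_def)
  have 2: "Poly_Mapping.lookup (\<alpha> - ?e j) i = Poly_Mapping.lookup \<alpha> i - (if i = j then 1 else 0)"
    by (simp add: lookup_minus lookup_single when_def)
  show "coeff (deriv_x i (xvar j * \<omega>)) \<alpha> I =
      coeff ((if i = j then \<omega> else 0) + xvar j * deriv_x i \<omega>) \<alpha> I"
    using 1 2 by (cases "Poly_Mapping.lookup \<alpha> j = 0")
      (auto simp: lookup_add lookup_single when_def algebra_simps simp del: One_nat_def)
qed

lemma deriv_x_theta_times:
  fixes \<omega> :: "('n::{finite,linorder}, 'k::comm_ring_1) superpoly"
  shows "deriv_x i (theta j * \<omega>) = theta j * deriv_x i \<omega>"
  by (rule superpoly_eqI) (simp add: algebra_simps)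

lemma deriv_theta_xvar_times:
  fixes \<omega> :: "('n::{finite,linorder}, 'k::comm_ring_1) superpoly"
  shows "deriv_theta i (xvar j * \<omega>) = xvar j * deriv_theta i \<omega>"
  by (rule superpoly_eqI) simp

lemma deriv_theta_theta_times:
  fixes \<omega> :: "('n::{finite,linorder}, 'k::comm_ring_1) superpoly"
  shows "deriv_theta i (theta j * \<omega>) = (if i = j then \<omega> else 0) - theta j * deriv_theta i \<omega>"
proof (rule superpoly_eqI)
  fix \<alpha> I
  show "coeff (deriv_theta i (theta j * \<omega>)) \<alpha> I =
      coeff ((if i = j then \<omega> else 0) - theta j * deriv_theta i \<omega>) \<alpha> I"
  proof (cases "i = j")
    case True
    then show ?thesis by (cases "i \<in> I") (simp_all add: sign_below_insert sign_below_remove insert_absorb)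
  next
    case False
    then show ?thesis
      by (cases i j rule: linorder_cases)
        (auto simp: sign_below_insert sign_below_remove insert_Diff_if algebra_simps)
  qed
qed

lemma deriv_commute:
  fixes \<omega> :: "('n::{finite,linorder}, 'k::comm_ring_1) superpoly"
  shows "deriv_x i (deriv_x j \<omega>) = deriv_x j (deriv_x i \<omega>)"
    and "deriv_x i (deriv_theta j \<omega>) = deriv_theta j (deriv_x i \<omega>)"
    and "deriv_theta i (deriv_theta j \<omega>) = - deriv_theta j (deriv_theta i \<omega>)"
    and "deriv_theta i (deriv_theta i \<omega>) = 0"
proof -
  show "deriv_x i (deriv_x j \<omega>) = deriv_x j (deriv_x i \<omega>)"
    by (rule superpoly_eqI) (auto simp: lookup_add lookup_single when_def algebra_simps)
  show "deriv_x i (deriv_theta j \<omega>) = deriv_theta j (deriv_x i \<omega>)"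
    by (rule superpoly_eqI) (simp add: algebra_simps)
  show "deriv_theta i (deriv_theta j \<omega>) = - deriv_theta j (deriv_theta i \<omega>)"
    by (rule superpoly_eqI, cases i j rule: linorder_cases)
      (auto simp: sign_below_insert insert_commute algebra_simps)
  show "deriv_theta i (deriv_theta i \<omega>) = 0"
    by (rule superpoly_eqI) simp
qed

text \<open>
  The Koszul differential: the antiderivation with \<open>\<theta>\<^sub>i \<mapsto> x\<^sub>i\<close> and \<open>x\<^sub>i \<mapsto> 0\<close>.
\<close>

definition euler_contraction ::
    "('n::{finite,linorder}, 'k::comm_ring_1) superpoly \<Rightarrow> ('n, 'k) superpoly" where
  "euler_contraction \<omega> = (\<Sum>i\<in>UNIV. xvar i * deriv_theta i \<omega>)"

text \<open>
  The algebra automorphism with \<open>x\<^sub>i \<mapsto> x\<^sub>i\<close> and \<open>\<theta>\<^sub>i \<mapsto> - \<theta>\<^sub>i\<close>. It lets the sign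
  rules of antiderivations be stated for forms of mixed \<open>\<theta>\<close>-degree.
\<close>

definition parity_involution ::
    "('n::{finite,linorder}, 'k::comm_ring_1) superpoly \<Rightarrow> ('n, 'k) superpoly" where
  "parity_involution \<omega> = Exterior (\<lambda>I. (- 1) ^ card I * coeff_theta \<omega> I)"

lemma coeff_parity_involution [simp]:
  "coeff (parity_involution \<omega>) \<alpha> I = (- 1) ^ card I * coeff \<omega> \<alpha> I"
  by (auto simp: coeff_def parity_involution_def Exterior_inverse minus_one_power_iff)

lemma parity_involution_rules:
  fixes \<omega> \<eta> :: "('n::{finite,linorder}, 'k::comm_ring_1) superpoly"
  shows "parity_involution (\<omega> + \<eta>) = parity_involution \<omega> + parity_involution \<eta>"
    and "parity_involution (const c :: ('n, 'k) superpoly) = const c"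
    and "parity_involution (const c * \<omega>) = const c * parity_involution \<omega>"
    and "parity_involution (xvar i * \<omega>) = xvar i * parity_involution \<omega>"
    and "parity_involution (theta i * \<omega>) = - (theta i * parity_involution \<omega>)"
proof -
  show "parity_involution (theta i * \<omega>) = - (theta i * parity_involution \<omega>)"
  proof (rule superpoly_eqI)
    fix \<alpha> I
    have "(- 1) ^ card I = - ((- 1) ^ card (I - {i}) :: 'k)" if "i \<in> I"
      using card_Suc_Diff1[of I i] that by (metis finite mult_minus1 power_Suc)
    then show "coeff (parity_involution (theta i * \<omega>)) \<alpha> I =
        coeff (- (theta i * parity_involution \<omega>)) \<alpha> I"
      by (simp add: algebra_simps)
  qed
qed (rule superpoly_eqI, simp add: algebra_simps)+

lemma ext_d_alt: "ext_d \<omega> = (\<Sum>i\<in>UNIV. theta i * deriv_x i \<omega>)"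
  by (simp add: ext_d_def deriv_x_theta_times)

lemma theta_left_anticommute:
  fixes \<omega> :: "('n::{finite,linorder}, 'k::comm_ring_1) superpoly"
  shows "theta i * (theta j * \<omega>) = - (theta j * (theta i * \<omega>))"
  unfolding mult.assoc[symmetric] theta_anticommute[of i j] by simp

lemma ext_d_rules:
  fixes \<omega> \<eta> :: "('n::{finite,linorder}, 'k::comm_ring_1) superpoly"
  shows "ext_d (\<omega> + \<eta>) = ext_d \<omega> + ext_d \<eta>"
    and "ext_d (const c :: ('n, 'k) superpoly) = 0"
    and "ext_d (const c * \<omega>) = const c * ext_d \<omega>"
    and "ext_d (xvar i * \<omega>) = theta i * \<omega> + xvar i * ext_d \<omega>"
    and "ext_d (theta i * \<omega>) = - (theta i * ext_d \<omega>)"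
proof -
  show "ext_d (\<omega> + \<eta>) = ext_d \<omega> + ext_d \<eta>"
    by (simp add: ext_d_alt deriv_linear distrib_left sum.distrib)
  show "ext_d (const c :: ('n, 'k) superpoly) = 0"
    by (simp add: ext_d_alt deriv_const)
  show "ext_d (const c * \<omega>) = const c * ext_d \<omega>"
    by (simp add: ext_d_alt deriv_linear const_left_commute sum_distrib_left)
  show "ext_d (xvar i * \<omega>) = theta i * \<omega> + xvar i * ext_d \<omega>"
    by (simp add: ext_d_alt deriv_x_xvar_times distrib_left sum.distrib sum_distrib_left
        xvar_left_commute if_distrib[of "(*) _"] cong: if_cong)
  show "ext_d (theta i * \<omega>) = - (theta i * ext_d \<omega>)"
    by (simp add: ext_d_alt deriv_x_theta_times theta_left_anticommute[of _ i] sum_distrib_left sum_negf)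
qed

lemma euler_contraction_rules:
  fixes \<omega> \<eta> :: "('n::{finite,linorder}, 'k::comm_ring_1) superpoly"
  shows "euler_contraction (\<omega> + \<eta>) = euler_contraction \<omega> + euler_contraction \<eta>"
    and "euler_contraction (const c :: ('n, 'k) superpoly) = 0"
    and "euler_contraction (const c * \<omega>) = const c * euler_contraction \<omega>"
    and "euler_contraction (xvar i * \<omega>) = xvar i * euler_contraction \<omega>"
    and "euler_contraction (theta i * \<omega>) = xvar i * \<omega> - theta i * euler_contraction \<omega>"
proof -
  show "euler_contraction (\<omega> + \<eta>) = euler_contraction \<omega> + euler_contraction \<eta>"
    by (simp add: euler_contraction_def deriv_linear distrib_left sum.distrib)
  show "euler_contraction (const c :: ('n, 'k) superpoly) = 0"
    by (simp add: euler_contraction_def deriv_const)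
  show "euler_contraction (const c * \<omega>) = const c * euler_contraction \<omega>"
    by (simp add: euler_contraction_def deriv_linear const_left_commute sum_distrib_left)
  show "euler_contraction (xvar i * \<omega>) = xvar i * euler_contraction \<omega>"
    by (simp add: euler_contraction_def deriv_theta_xvar_times sum_distrib_left
        xvar_left_commute[of "xvar _" i])
  show "euler_contraction (theta i * \<omega>) = xvar i * \<omega> - theta i * euler_contraction \<omega>"
    by (simp add: euler_contraction_def deriv_theta_theta_times right_diff_distrib sum_subtractf
        sum_distrib_left xvar_left_commute[of "theta i"] if_distrib[of "(*) _"] cong: if_cong)
qed

lemma additive_operators:
  "Modules.additive (ext_d :: ('n::{finite,linorder}, 'k::comm_ring_1) superpoly \<Rightarrow> _)"
  "Modules.additive (euler_contraction :: ('n, 'k) superpoly \<Rightarrow> _)"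
  "Modules.additive (parity_involution :: ('n, 'k) superpoly \<Rightarrow> _)"
  "Modules.additive (deriv_x i :: ('n, 'k) superpoly \<Rightarrow> _)"
  "Modules.additive (deriv_theta i :: ('n, 'k) superpoly \<Rightarrow> _)"
  "Modules.additive (\<lambda>\<omega> :: ('n, 'k) superpoly. \<eta> * \<omega>)"
  by (standard; simp add: ext_d_rules euler_contraction_rules parity_involution_rules deriv_linear distrib_left)+

lemmas additive_minus = additive_operators[THEN additive.minus]
lemmas additive_diff = additive_operators[THEN additive.diff]
lemmas additive_sum = additive_operators[THEN additive.sum]
lemmas additive_zero = additive_operators[THEN additive.zero]

lemma operators_zero [simp]:
  "ext_d (0 :: ('n::{finite,linorder}, 'k::comm_ring_1) superpoly) = 0"
  "euler_contraction (0 :: ('n, 'k) superpoly) = 0"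
  by (rule additive_zero)+

lemma parity_involution_times:
  fixes \<omega> \<eta> :: "('n::{finite,linorder}, 'k::comm_ring_1) superpoly"
  shows "parity_involution (\<omega> * \<eta>) = parity_involution \<omega> * parity_involution \<eta>"
  by (induction \<omega> rule: superpoly_induct)
    (simp_all add: parity_involution_rules distrib_right mult.assoc)

text \<open>
  The product rules make an ideal stable under both operators as soon as they and the parity
  involution map its generators into it.
\<close>

lemma ext_d_times:
  fixes \<omega> \<eta> :: "('n::{finite,linorder}, 'k::comm_ring_1) superpoly"
  shows "ext_d (\<omega> * \<eta>) = ext_d \<omega> * \<eta> + parity_involution \<omega> * ext_d \<eta>"
  by (induction \<omega> rule: superpoly_induct)
    (simp_all add: ext_d_rules parity_involution_rules mult.assoc algebra_simps)

lemma euler_contraction_times: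
  fixes \<omega> \<eta> :: "('n::{finite,linorder}, 'k::comm_ring_1) superpoly"
  shows "euler_contraction (\<omega> * \<eta>) = euler_contraction \<omega> * \<eta> + parity_involution \<omega> * euler_contraction \<eta>"
  by (induction \<omega> rule: superpoly_induct)
    (simp_all add: euler_contraction_rules parity_involution_rules mult.assoc algebra_simps)

lemma ext_d_square:
  fixes \<omega> :: "('n::{finite,linorder}, 'k::comm_ring_1) superpoly"
  shows "ext_d (ext_d \<omega>) = 0"
  by (induction \<omega> rule: superpoly_induct) (simp_all add: ext_d_rules additive_minus additive_zero)

text \<open>
  Both sides are derivations that multiply each of \<open>x\<^sub>i\<close> and \<open>\<theta>\<^sub>i\<close> by one.
\<close>

lemma cartan_formula:
  fixes \<omega> :: "('n::{finite,linorder}, 'k::comm_ring_1) superpoly"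
  shows "coeff (ext_d (euler_contraction \<omega>) + euler_contraction (ext_d \<omega>)) \<alpha> I =
    of_nat (xdegree \<alpha> + card I) * coeff \<omega> \<alpha> I"
proof (induction \<omega> arbitrary: \<alpha> I rule: superpoly_induct)
  case (const c)
  then show ?case by (simp add: ext_d_rules euler_contraction_rules additive_zero xdegree_def)
next
  case (add \<omega> \<eta>)
  let ?E = "\<lambda>\<omega>. ext_d (euler_contraction \<omega>) + euler_contraction (ext_d \<omega>)"
  have "?E (\<omega> + \<eta>) = ?E \<omega> + ?E \<eta>"
    by (simp add: ext_d_rules euler_contraction_rules)
  then have "coeff (?E (\<omega> + \<eta>)) \<alpha> I = coeff (?E \<omega>) \<alpha> I + coeff (?E \<eta>) \<alpha> I"
    by (simp only: coeff_add[of "?E \<omega>" "?E \<eta>"])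
  then show ?case by (simp only: add coeff_add[of \<omega> \<eta>] distrib_left)
next
  case (xvar i \<omega>)
  let ?E = "\<lambda>\<omega>. ext_d (euler_contraction \<omega>) + euler_contraction (ext_d \<omega>)"
  have "?E (xvar i * \<omega>) = xvar i * \<omega> + xvar i * ?E \<omega>"
    by (simp add: ext_d_rules euler_contraction_rules algebra_simps)
  then have *: "coeff (?E (xvar i * \<omega>)) \<alpha> I = coeff (xvar i * \<omega>) \<alpha> I + coeff (xvar i * ?E \<omega>) \<alpha> I"
    by (simp only: coeff_add[of "xvar i * \<omega>"])
  show ?case
  proof (cases "Poly_Mapping.lookup \<alpha> i = 0")
    case False
    with xdegree_minus_single[OF False] show ?thesis
      unfolding * coeff_xvar_times xvar
      by (simp add: algebra_simps flip: xdegree_minus_single[OF False])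
  qed (simp only: * coeff_xvar_times, simp)
next
  case (theta i \<omega>)
  let ?E = "\<lambda>\<omega>. ext_d (euler_contraction \<omega>) + euler_contraction (ext_d \<omega>)"
  have "?E (theta i * \<omega>) = theta i * \<omega> + theta i * ?E \<omega>"
    by (simp add: ext_d_rules euler_contraction_rules additive_diff additive_minus algebra_simps)
  then have *: "coeff (?E (theta i * \<omega>)) \<alpha> I = coeff (theta i * \<omega>) \<alpha> I + coeff (theta i * ?E \<omega>) \<alpha> I"
    by (simp only: coeff_add[of "theta i * \<omega>"])
  show ?case
  proof (cases "i \<in> I")
    case True
    then have "card I = Suc (card (I - {i}))"
      by (metis card_Suc_Diff1 finite)
    with True show ?thesis
      unfolding * coeff_theta_times theta by (simp only: if_True of_nat_add of_nat_Suc mult_1_left algebra_simps)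
  qed (simp only: * coeff_theta_times, simp)
qed

text \<open>
  The commutators of \<open>d\<close> and of the Euler contraction with the partial derivatives mirror the rules
  for their action on products with \<open>\<theta>\<^sub>i\<close> and \<open>x\<^sub>i\<close>, with the two operators exchanged. This
  is the source of their adjointness.
\<close>

lemma deriv_ext_d:
  fixes \<eta> :: "('n::{finite,linorder}, 'k::comm_ring_1) superpoly"
  shows "deriv_x i (ext_d \<eta>) = ext_d (deriv_x i \<eta>)"
    and "deriv_theta i (ext_d \<eta>) = deriv_x i \<eta> - ext_d (deriv_theta i \<eta>)"
proof -
  show "deriv_x i (ext_d \<eta>) = ext_d (deriv_x i \<eta>)"
    by (simp add: ext_d_alt additive_sum deriv_x_theta_times deriv_commute(1)[of i])
  show "deriv_theta i (ext_d \<eta>) = deriv_x i \<eta> - ext_d (deriv_theta i \<eta>)"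
    by (simp add: ext_d_alt additive_sum deriv_theta_theta_times deriv_commute(2) sum_subtractf)
qed

lemma deriv_euler_contraction:
  fixes \<eta> :: "('n::{finite,linorder}, 'k::comm_ring_1) superpoly"
  shows "deriv_x i (euler_contraction \<eta>) = deriv_theta i \<eta> + euler_contraction (deriv_x i \<eta>)"
    and "deriv_theta i (euler_contraction \<eta>) = - euler_contraction (deriv_theta i \<eta>)"
proof -
  show "deriv_x i (euler_contraction \<eta>) = deriv_theta i \<eta> + euler_contraction (deriv_x i \<eta>)"
    by (simp add: euler_contraction_def additive_sum deriv_x_xvar_times deriv_commute(2) sum.distrib)
  show "deriv_theta i (euler_contraction \<eta>) = - euler_contraction (deriv_theta i \<eta>)"
    by (simp add: euler_contraction_def additive_sum deriv_theta_xvar_times deriv_commute(3)[of i]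
        additive_minus sum_negf)
qed

section \<open>Evaluating superpolynomials at operators\<close>

definition const_linear ::
    "(('n::{finite,linorder}, 'k::comm_ring_1) superpoly \<Rightarrow> ('n, 'k) superpoly) \<Rightarrow> bool" where
  "const_linear f \<longleftrightarrow>
     (\<forall>\<omega> \<eta>. f (\<omega> + \<eta>) = f \<omega> + f \<eta>) \<and> (\<forall>c \<omega>. f (const c * \<omega>) = const c * f \<omega>)"

lemma const_linearD:
  assumes "const_linear f"
  shows "f (\<omega> + \<eta>) = f \<omega> + f \<eta>" "f (const c * \<omega>) = const c * f \<omega>"
    "f 0 = 0" "f (- \<omega>) = - f \<omega>" "f (\<omega> - \<eta>) = f \<omega> - f \<eta>"
proof -
  show add: "f (\<omega> + \<eta>) = f \<omega> + f \<eta>" for \<omega> \<eta>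
    using assms by (simp add: const_linear_def)
  then interpret additive f by unfold_locales
  show "f 0 = 0" "f (- \<omega>) = - f \<omega>" "f (\<omega> - \<eta>) = f \<omega> - f \<eta>"
    by (rule zero, rule minus, rule diff)
  show "f (const c * \<omega>) = const c * f \<omega>"
    using assms by (simp add: const_linear_def)
qed

lemma const_linear_funpow: "const_linear f \<Longrightarrow> const_linear (f ^^ m)"
  by (induction m) (simp_all add: const_linear_def)

lemma const_linear_fold: "(\<And>i. const_linear (F i)) \<Longrightarrow> const_linear (fold F xs)"
  by (induction xs) (simp_all add: const_linear_def)

lemma funpow_commute_apply: "(\<And>z. g (f z) = f (g z)) \<Longrightarrow> g ((f ^^ m) z) = (f ^^ m) (g z)"
  by (induction m) simp_all

lemma fold_commute_all: "(\<And>i z. g (F i z) = F i (g z)) \<Longrightarrow> g (fold F xs z) = fold F xs (g z)"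
  by (induction xs arbitrary: z) simp_all

text \<open>
  Both \<open>\<omega> \<mapsto> \<partial>\<^sub>\<omega>\<close> and the action of a matrix substitute operators for the variables: in the
  first case the partial derivatives, in the second left multiplication by the images of the
  \<open>x\<^sub>i\<close> and right multiplication by the images of the \<open>\<theta>\<^sub>i\<close>. The operators satisfy the
  relations of the variables, so the substitution is well behaved under multiplication, but it
  reverses the order of factors, and it transforms the coefficients by the ring endomorphism \<open>C\<close>.
\<close>

locale superpoly_evaluation =
  fixes C :: "'k::field \<Rightarrow> 'k"
    and Xop Top :: "'n::{finite,linorder} \<Rightarrow> ('n, 'k) superpoly \<Rightarrow> ('n, 'k) superpoly"
  assumes C_one: "C 1 = 1"
    and C_add: "C (a + b) = C a + C b"
    and C_mult: "C (a * b) = C a * C b"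
    and X_linear: "const_linear (Xop i)"
    and T_linear: "const_linear (Top i)"
    and X_X: "Xop i (Xop j \<eta>) = Xop j (Xop i \<eta>)"
    and X_T: "Xop i (Top j \<eta>) = Top j (Xop i \<eta>)"
    and T_T: "Top i (Top j \<eta>) = - Top j (Top i \<eta>)"
    and T_square: "Top i (Top i \<eta>) = 0"
begin

definition monomial_op :: "('n \<Rightarrow>\<^sub>0 nat) \<Rightarrow> 'n set \<Rightarrow> ('n, 'k) superpoly \<Rightarrow> ('n, 'k) superpoly" where
  "monomial_op \<alpha> I \<eta> = fold (\<lambda>i. Xop i ^^ Poly_Mapping.lookup \<alpha> i) (sorted_list_of_set UNIV)
     (fold Top (sorted_list_of_set I) \<eta>)"

definition evaluate :: "('n, 'k) superpoly \<Rightarrow> ('n, 'k) superpoly \<Rightarrow> ('n, 'k) superpoly" where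
  "evaluate \<omega> \<eta> = (\<Sum>(\<alpha>, I)\<in>supp \<omega>. const (C (coeff \<omega> \<alpha> I)) * monomial_op \<alpha> I \<eta>)"

lemma C_zero [simp]: "C 0 = 0"
  using C_add[of 0 0] by (simp only: add_0_right add_cancel_right_right)

lemma C_sign [simp]: "C (sign_below i I) = sign_below i I"
proof -
  have "C (- 1) = - 1"
    using C_add[of 1 "- 1"] C_one by (simp add: eq_neg_iff_add_eq_0 add.commute)
  then have "C ((- 1) ^ m) = (- 1) ^ m" for m
    by (induction m) (simp_all only: power_0 power_Suc C_one C_mult)
  then show ?thesis by (simp add: sign_below_def)
qed

lemma monomial_op_linear: "const_linear (monomial_op \<alpha> I)"
proof -
  have "const_linear (fold Top (sorted_list_of_set I))"
    "const_linear (fold (\<lambda>i. Xop i ^^ Poly_Mapping.lookup \<alpha> i) (sorted_list_of_set UNIV))"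
    by (intro const_linear_fold const_linear_funpow X_linear T_linear)+
  then show ?thesis by (simp add: const_linear_def monomial_op_def)
qed

lemma monomial_op_zero: "monomial_op 0 {} \<eta> = \<eta>"
proof -
  have "fold (\<lambda>i. Xop i ^^ 0) xs \<eta> = \<eta>" for xs
    by (induction xs) simp_all
  then show ?thesis by (simp add: monomial_op_def)
qed

lemma monomial_op_X: "monomial_op (\<alpha> + Poly_Mapping.single i 1) I \<eta> = monomial_op \<alpha> I (Xop i \<eta>)"
proof -
  have X_pow: "Xop i ((Xop j ^^ m) z) = (Xop j ^^ m) (Xop i z)" for j m z
    by (rule funpow_commute_apply) (rule X_X)
  have "fold (\<lambda>j. Xop j ^^ (Poly_Mapping.lookup \<alpha> j + (if i = j then 1 else 0))) xs z =
      fold (\<lambda>j. Xop j ^^ Poly_Mapping.lookup \<alpha> j) xs (if i \<in> set xs then Xop i z else z)"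
    if "distinct xs" for xs z
    using that
    by (induction xs arbitrary: z) (auto simp: X_pow)
  moreover have "Xop i (fold Top xs z) = fold Top xs (Xop i z)" for xs z
    by (rule fold_commute_all) (rule X_T)
  ultimately show ?thesis
    by (simp add: monomial_op_def lookup_add lookup_single when_def del: One_nat_def)
qed

text \<open>
  Moving the operator of \<open>i\<close> to its place in the increasing order costs one sign for every smaller
  index that it passes.
\<close>

lemma fold_T_insort:
  assumes "sorted_wrt (<) xs" "i \<notin> set xs"
  shows "fold Top xs (Top i \<eta>) = const (sign_below i (set xs)) * fold Top (insort i xs) \<eta>"
  using assms
proof (induction xs arbitrary: \<eta>)
  case Nil
  then show ?case by (simp add: sign_below_def const_hom)
next
  case (Cons x xs)
  show ?case
  proof (cases "i < x")
    case True
    then have "{j \<in> set (x # xs). j < i} = {}" using Cons(2) by auto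
    then have "sign_below i (set (x # xs)) = (1 :: 'k)"
      unfolding sign_below_def by (metis card.empty power_0)
    with True show ?thesis by (simp add: const_hom less_imp_le)
  next
    case False
    with Cons have "x < i" "\<not> i \<le> x" "x \<notin> set xs" by auto
    then show ?thesis
      using Cons const_linearD[OF const_linear_fold[of Top, OF T_linear]]
      by (simp add: T_T[of x i] sign_below_insert const_hom)
  qed
qed

lemma fold_T_member:
  assumes "i \<in> set xs"
  shows "fold Top xs (Top i \<eta>) = 0"
  using assms
proof (induction xs arbitrary: \<eta>)
  case (Cons x xs)
  note [simp] = const_linearD[OF const_linear_fold[of Top, OF T_linear]]
  show ?case
  proof (cases "x = i")
    case False
    with Cons show ?thesis by (simp add: T_T[of x i])
  qed (simp add: T_square)
qed simp

lemma monomial_op_T: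
  "monomial_op \<alpha> I (Top i \<eta>) =
    (if i \<in> I then 0 else const (sign_below i I) * monomial_op \<alpha> (insert i I) \<eta>)"
proof -
  note [simp] = const_linearD[OF const_linear_fold[of "\<lambda>i. Xop i ^^ Poly_Mapping.lookup \<alpha> i",
        OF const_linear_funpow, OF X_linear]]
  show ?thesis
    by (auto simp: monomial_op_def fold_T_member fold_T_insort)
qed

lemma evaluate_superset:
  assumes "finite A" "supp \<omega> \<subseteq> A"
  shows "evaluate \<omega> \<eta> = (\<Sum>(\<alpha>, I)\<in>A. const (C (coeff \<omega> \<alpha> I)) * monomial_op \<alpha> I \<eta>)"
  unfolding evaluate_def
  by (rule sum.mono_neutral_left) (use assms in \<open>auto simp: supp_def const_hom\<close>)

lemma evaluate_add: "evaluate (\<omega> + \<omega>') \<eta> = evaluate \<omega> \<eta> + evaluate \<omega>' \<eta>"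
proof -
  let ?A = "supp \<omega> \<union> supp \<omega>'"
  have "finite ?A" by (simp add: finite_supp)
  moreover have "supp (\<omega> + \<omega>') \<subseteq> ?A" by (auto simp: supp_def)
  ultimately show ?thesis
    by (simp add: evaluate_superset[of ?A] C_add const_hom distrib_right sum.distrib split_beta)
qed

lemma evaluate_const: "evaluate (const c) \<eta> = const (C c) * \<eta>"
proof -
  have "supp (const c) \<subseteq> {(0, {})}" by (auto simp: supp_def split: if_splits)
  then show ?thesis
    using evaluate_superset[of "{(0, {})}" "const c" \<eta>] by (simp add: monomial_op_zero)
qed

lemma evaluate_const_times: "evaluate (const c * \<omega>) \<eta> = const (C c) * evaluate \<omega> \<eta>"
proof -
  have "supp (const c * \<omega>) \<subseteq> supp \<omega>" by (auto simp: supp_def)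
  then show ?thesis
    using finite_supp[of \<omega>]
    by (simp add: evaluate_superset[of "supp \<omega>"] C_mult const_hom mult.assoc sum_distrib_left split_beta)
qed

text \<open>
  The reversal of factors shows here: a variable multiplied on the left becomes the innermost operator.
\<close>

lemma evaluate_xvar: "evaluate (xvar i * \<omega>) \<eta> = evaluate \<omega> (Xop i \<eta>)"
proof -
  let ?e = "Poly_Mapping.single i (1::nat)"
  let ?f = "\<lambda>(\<alpha>, I). (\<alpha> + ?e, I :: 'n set)"
  have "supp (xvar i * \<omega>) \<subseteq> ?f ` supp \<omega>"
  proof
    fix p assume p: "p \<in> supp (xvar i * \<omega>)"
    obtain \<alpha> I where [simp]: "p = (\<alpha>, I)" by (cases p)
    from p have "Poly_Mapping.lookup \<alpha> i \<noteq> 0" "(\<alpha> - ?e, I) \<in> supp \<omega>"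
      by (auto simp: supp_def split: if_splits)
    with shift_exponent[of \<alpha> i] show "p \<in> ?f ` supp \<omega>"
      by (intro image_eqI[of _ _ "(\<alpha> - ?e, I)"]) (simp_all add: add.commute)
  qed
  then have "evaluate (xvar i * \<omega>) \<eta> =
      (\<Sum>(\<alpha>, I)\<in>?f ` supp \<omega>. const (C (coeff (xvar i * \<omega>) \<alpha> I)) * monomial_op \<alpha> I \<eta>)"
    by (intro evaluate_superset finite_imageI finite_supp)
  also have "\<dots> = (\<Sum>(\<alpha>, I)\<in>supp \<omega>. const (C (coeff \<omega> \<alpha> I)) * monomial_op \<alpha> I (Xop i \<eta>))"
    by (subst sum.reindex)
      (auto simp: inj_on_def split_beta lookup_add monomial_op_X simp del: One_nat_def intro!: sum.cong)
  finally show ?thesis by (simp add: evaluate_def)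
qed

lemma evaluate_theta: "evaluate (theta i * \<omega>) \<eta> = evaluate \<omega> (Top i \<eta>)"
proof -
  let ?f = "\<lambda>(\<alpha> :: 'n \<Rightarrow>\<^sub>0 nat, I). (\<alpha>, insert i I)"
  let ?A = "{p \<in> supp \<omega>. i \<notin> snd p}"
  have fin: "finite ?A" using finite_supp[of \<omega>] by simp
  have "supp (theta i * \<omega>) \<subseteq> ?f ` ?A"
  proof
    fix p assume p: "p \<in> supp (theta i * \<omega>)"
    obtain \<alpha> I where [simp]: "p = (\<alpha>, I)" by (cases p)
    from p have "i \<in> I" "(\<alpha>, I - {i}) \<in> supp \<omega>"
      by (auto simp: supp_def split: if_splits)
    then show "p \<in> ?f ` ?A"
      by (intro image_eqI[of _ _ "(\<alpha>, I - {i})"]) auto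
  qed
  then have "evaluate (theta i * \<omega>) \<eta> =
      (\<Sum>(\<alpha>, I)\<in>?f ` ?A. const (C (coeff (theta i * \<omega>) \<alpha> I)) * monomial_op \<alpha> I \<eta>)"
    using fin by (intro evaluate_superset finite_imageI)
  also have "\<dots> = (\<Sum>(\<alpha>, I)\<in>?A. const (C (coeff \<omega> \<alpha> I)) * monomial_op \<alpha> I (Top i \<eta>))"
  proof (subst sum.reindex)
    show "inj_on ?f ?A" by (auto simp: inj_on_def)
  qed (auto simp: monomial_op_T sign_below_insert C_mult const_const_times mult.commute intro!: sum.cong)
  also have "\<dots> = (\<Sum>(\<alpha>, I)\<in>supp \<omega>. const (C (coeff \<omega> \<alpha> I)) * monomial_op \<alpha> I (Top i \<eta>))"
    by (rule sum.mono_neutral_left) (auto simp: finite_supp monomial_op_T)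
  finally show ?thesis by (simp add: evaluate_def)
qed

lemmas evaluate_rules = evaluate_add evaluate_const evaluate_const_times evaluate_xvar evaluate_theta

lemma evaluate_linear: "const_linear (evaluate \<omega>)"
  using const_linearD[OF monomial_op_linear]
  by (simp add: const_linear_def evaluate_def distrib_left sum.distrib sum_distrib_left split_beta
      const_const_times mult.commute)

text \<open>
  With \<open>g\<close> a left multiplication, this turns the innermost operator back into a left factor, which
  makes the action of a matrix multiplicative.
\<close>

lemma evaluate_commute:
  assumes "const_linear g" "\<And>i z. g (Xop i z) = Xop i (g z)" "\<And>i z. g (Top i z) = Top i (g z)"
  shows "g (evaluate \<omega> \<eta>) = evaluate \<omega> (g \<eta>)"
  by (induction \<omega> arbitrary: \<eta> rule: superpoly_induct)
    (simp_all add: evaluate_rules const_linearD[OF assms(1)] assms(2,3))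

end

section \<open>Differential operators and the group action\<close>

lemma conj_closed_embedding_inj:
  assumes "conj_closed_embedding \<iota>"
  shows "\<iota> 0 = 0" "\<iota> a = \<iota> b \<longleftrightarrow> a = b" "\<iota> (of_nat m) = of_nat m"
proof -
  have add: "\<And>a b. \<iota> (a + b) = \<iota> a + \<iota> b" and mult: "\<And>a b. \<iota> (a * b) = \<iota> a * \<iota> b"
    and one: "\<iota> 1 = 1"
    using assms by (auto simp: conj_closed_embedding_def)
  show zero: "\<iota> 0 = 0" using add[of 0 0] by simp
  show "\<iota> a = \<iota> b \<longleftrightarrow> a = b"
  proof (rule iffI, rule ccontr)
    assume eq: "\<iota> a = \<iota> b" and "a \<noteq> b"
    then have "\<iota> (a - b) * \<iota> (inverse (a - b)) = 1"
      by (simp add: one flip: mult)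
    moreover have "\<iota> (a - b) = 0"
      using add[of "a - b" b] eq by simp
    ultimately show False by simp
  qed simp
  show "\<iota> (of_nat m) = of_nat m"
    by (induction m) (simp_all add: zero add one)
qed

lemma conj_closed_embedding_of_nat_eq_0:
  assumes "conj_closed_embedding (\<iota> :: 'k::field \<Rightarrow> complex)"
  shows "(of_nat m :: 'k) = 0 \<longleftrightarrow> m = 0"
  using conj_closed_embedding_inj(2)[OF assms, of "of_nat m" 0] conj_closed_embedding_inj(1,3)[OF assms]
  by simp

lemma conj_of_hom:
  assumes "conj_closed_embedding \<iota>"
  shows "conj_of \<iota> 0 = 0" "conj_of \<iota> 1 = 1" "conj_of \<iota> (a + b) = conj_of \<iota> a + conj_of \<iota> b"
    "conj_of \<iota> (a * b) = conj_of \<iota> a * conj_of \<iota> b" "conj_of \<iota> (conj_of \<iota> a) = a"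
  using assms conj_closed_embedding_inj[OF assms]
  by (auto simp: emb_conj_of[OF assms] conj_closed_embedding_def
      simp flip: conj_closed_embedding_inj(2)[OF assms])

lemma conj_of_sum:
  assumes "conj_closed_embedding \<iota>"
  shows "conj_of \<iota> (\<Sum>i\<in>A. f i) = (\<Sum>i\<in>A. conj_of \<iota> (f i))"
  by (induction A rule: infinite_finite_induct) (simp_all add: conj_of_hom[OF assms])

lemma const_linear_deriv: "const_linear (deriv_x i)" "const_linear (deriv_theta i)"
  by (simp_all add: const_linear_def deriv_linear)

lemma diff_op_evaluation:
  assumes "conj_closed_embedding \<iota>"
  shows "superpoly_evaluation (conj_of \<iota>) deriv_x deriv_theta"
  by unfold_locales
    (fact conj_of_hom[OF assms] const_linear_deriv deriv_commute)+

lemma diff_op_eq_evaluate: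
  assumes "conj_closed_embedding \<iota>"
  shows "diff_op \<iota> \<omega> \<eta> = superpoly_evaluation.evaluate (conj_of \<iota>) deriv_x deriv_theta \<omega> \<eta>"
proof -
  interpret superpoly_evaluation "conj_of \<iota>" deriv_x deriv_theta
    by (rule diff_op_evaluation[OF assms])
  show ?thesis by (simp add: diff_op_def evaluate_def monomial_op_def)
qed

lemma diff_op_rules:
  assumes "conj_closed_embedding \<iota>"
  shows "diff_op \<iota> (\<omega> + \<omega>') \<eta> = diff_op \<iota> \<omega> \<eta> + diff_op \<iota> \<omega>' \<eta>"
    and "diff_op \<iota> (const c) \<eta> = const (conj_of \<iota> c) * \<eta>"
    and "diff_op \<iota> (const c * \<omega>) \<eta> = const (conj_of \<iota> c) * diff_op \<iota> \<omega> \<eta>"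
    and "diff_op \<iota> (xvar i * \<omega>) \<eta> = diff_op \<iota> \<omega> (deriv_x i \<eta>)"
    and "diff_op \<iota> (theta i * \<omega>) \<eta> = diff_op \<iota> \<omega> (deriv_theta i \<eta>)"
    and "const_linear (diff_op \<iota> \<omega>)"
proof -
  interpret superpoly_evaluation "conj_of \<iota>" deriv_x deriv_theta
    by (rule diff_op_evaluation[OF assms])
  have eq: "diff_op \<iota> = evaluate"
    by (intro ext) (rule diff_op_eq_evaluate[OF assms])
  show "diff_op \<iota> (\<omega> + \<omega>') \<eta> = diff_op \<iota> \<omega> \<eta> + diff_op \<iota> \<omega>' \<eta>"
    and "diff_op \<iota> (const c) \<eta> = const (conj_of \<iota> c) * \<eta>"
    and "diff_op \<iota> (const c * \<omega>) \<eta> = const (conj_of \<iota> c) * diff_op \<iota> \<omega> \<eta>"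
    and "diff_op \<iota> (xvar i * \<omega>) \<eta> = diff_op \<iota> \<omega> (deriv_x i \<eta>)"
    and "diff_op \<iota> (theta i * \<omega>) \<eta> = diff_op \<iota> \<omega> (deriv_theta i \<eta>)"
    and "const_linear (diff_op \<iota> \<omega>)"
    unfolding eq by (fact evaluate_rules evaluate_linear)+
qed

lemma diff_op_neg:
  assumes "conj_closed_embedding \<iota>"
  shows "diff_op \<iota> 0 \<eta> = 0" "diff_op \<iota> (- \<omega>) \<eta> = - diff_op \<iota> \<omega> \<eta>"
    "diff_op \<iota> (\<omega> - \<omega>') \<eta> = diff_op \<iota> \<omega> \<eta> - diff_op \<iota> \<omega>' \<eta>"
proof -
  interpret additive "\<lambda>\<omega>. diff_op \<iota> \<omega> \<eta>"
    by standard (rule diff_op_rules[OF assms])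
  show "diff_op \<iota> 0 \<eta> = 0" "diff_op \<iota> (- \<omega>) \<eta> = - diff_op \<iota> \<omega> \<eta>"
    "diff_op \<iota> (\<omega> - \<omega>') \<eta> = diff_op \<iota> \<omega> \<eta> - diff_op \<iota> \<omega>' \<eta>"
    by (rule zero, rule minus, rule diff)
qed

text \<open>
  The two adjointness relations. Peeling a variable off \<open>\<omega>\<close> moves its derivative to
  \<open>\<eta>\<close>, where it has to cross the outer operator; the commutator is the term that the
  antiderivation rule produces on \<open>\<omega>\<close>.
\<close>

lemma diff_op_ext_d:
  assumes "conj_closed_embedding \<iota>"
  shows "diff_op \<iota> \<omega> (ext_d \<eta>) =
    diff_op \<iota> (euler_contraction \<omega>) \<eta> + ext_d (diff_op \<iota> (parity_involution \<omega>) \<eta>)"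
  by (induction \<omega> arbitrary: \<eta> rule: superpoly_induct)
    (simp_all add: const_linearD[OF diff_op_rules(6)[OF assms]] diff_op_rules[OF assms] diff_op_neg[OF assms] ext_d_rules euler_contraction_rules
      parity_involution_rules deriv_ext_d additive_minus)

lemma diff_op_euler_contraction:
  assumes "conj_closed_embedding \<iota>"
  shows "diff_op \<iota> \<omega> (euler_contraction \<eta>) =
    diff_op \<iota> (ext_d \<omega>) \<eta> + euler_contraction (diff_op \<iota> (parity_involution \<omega>) \<eta>)"
  by (induction \<omega> arbitrary: \<eta> rule: superpoly_induct)
    (simp_all add: const_linearD[OF diff_op_rules(6)[OF assms]] diff_op_rules[OF assms] diff_op_neg[OF assms] ext_d_rules euler_contraction_rules
      parity_involution_rules deriv_euler_contraction additive_minus)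

text \<open>
  All derivatives kill constants, so only the constant term of \<open>\<omega>\<close> acts.
\<close>

lemma diff_op_constant:
  assumes "conj_closed_embedding \<iota>"
  shows "diff_op \<iota> \<omega> (const c) = const (conj_of \<iota> (coeff \<omega> 0 {}) * c)"
  by (induction \<omega> rule: superpoly_induct)
    (simp_all add: const_linearD[OF diff_op_rules(6)[OF assms]] diff_op_rules[OF assms] deriv_const conj_of_hom[OF assms] const_hom distrib_right)

lemma act_x_commute: "\<omega> * act_x \<iota> A i = act_x \<iota> A i * \<omega>"
  unfolding act_x_def sum_distrib_left sum_distrib_right
  by (simp only: const_left_commute[of \<omega>] xvar_commute[of \<omega>] mult.assoc)

lemma act_theta_anticommute: "act_theta \<iota> A i * act_theta \<iota> A j = - (act_theta \<iota> A j * act_theta \<iota> A i)"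
proof -
  have "theta a * act_theta \<iota> A j = - (act_theta \<iota> A j * theta a)" for a
    unfolding act_theta_def sum_distrib_left sum_distrib_right sum_negf[symmetric]
    by (simp only: const_left_commute[of "theta a"] theta_anticommute[of a] mult_minus_right mult.assoc)
  then show ?thesis
    unfolding act_theta_def[of \<iota> A i] sum_distrib_left sum_distrib_right sum_negf[symmetric]
    by (simp only: const_left_commute[of "act_theta \<iota> A j"] mult_minus_right mult.assoc)
qed

lemma eq_neg_imp_eq_0:
  assumes "conj_closed_embedding (\<iota> :: 'k::field \<Rightarrow> complex)" "(c :: 'k) = - c"
  shows "c = 0"
proof -
  have "of_nat 2 * c = c + c"
    by (simp only: of_nat_numeral mult_2)
  also have "\<dots> = 0"
    using assms(2) unfolding eq_neg_iff_add_eq_0 .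
  finally have "(of_nat 2 :: 'k) = 0 \<or> c = 0"
    unfolding mult_eq_0_iff .
  moreover have "(of_nat 2 :: 'k) \<noteq> 0"
    unfolding conj_closed_embedding_of_nat_eq_0[OF assms(1)] by simp
  ultimately show ?thesis by blast
qed

text \<open>
  Anticommutativity alone gives \<open>2 t\<^sup>2 = 0\<close>, and \<open>2\<close> is invertible.
\<close>

lemma act_theta_square:
  assumes "conj_closed_embedding (\<iota> :: 'k::field \<Rightarrow> complex)"
  shows "act_theta \<iota> A i * act_theta \<iota> A i = 0"
proof (rule superpoly_eqI)
  fix \<alpha> I
  have "coeff (act_theta \<iota> A i * act_theta \<iota> A i) \<alpha> I = - coeff (act_theta \<iota> A i * act_theta \<iota> A i) \<alpha> I"
    using arg_cong[OF act_theta_anticommute[of \<iota> A i i], of "\<lambda>\<omega>. coeff \<omega> \<alpha> I"]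
    unfolding coeff_uminus .
  from eq_neg_imp_eq_0[OF assms this]
  show "coeff (act_theta \<iota> A i * act_theta \<iota> A i) \<alpha> I = coeff 0 \<alpha> I"
    unfolding coeff_zero .
qed

lemma act_evaluation:
  assumes "conj_closed_embedding \<iota>"
  shows "superpoly_evaluation (\<lambda>c. c) (\<lambda>i z. act_x \<iota> A i * z) (\<lambda>i z. z * act_theta \<iota> A i)"
proof
  fix i j and z :: "('b, 'a) superpoly"
  show "act_x \<iota> A i * (act_x \<iota> A j * z) = act_x \<iota> A j * (act_x \<iota> A i * z)"
    by (simp only: mult.assoc[symmetric] act_x_commute[of "act_x \<iota> A i" \<iota> A j])
  show "z * act_theta \<iota> A j * act_theta \<iota> A i = - (z * act_theta \<iota> A i * act_theta \<iota> A j)"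
    by (simp only: mult.assoc act_theta_anticommute[of \<iota> A j i] mult_minus_right)
  show "z * act_theta \<iota> A i * act_theta \<iota> A i = 0"
    by (simp only: mult.assoc act_theta_square[OF assms] mult_zero_right)
  show "const_linear (\<lambda>z. act_x \<iota> A i * z)"
    unfolding const_linear_def by (simp only: distrib_left const_left_commute[of "act_x \<iota> A i"] simp_thms)
  show "const_linear (\<lambda>z. z * act_theta \<iota> A i)"
    unfolding const_linear_def by (simp only: distrib_right mult.assoc simp_thms)
  show "act_x \<iota> A i * (z * act_theta \<iota> A j) = act_x \<iota> A i * z * act_theta \<iota> A j"
    by (simp only: mult.assoc)
qed (rule refl)+

lemma act_eq_evaluate:
  assumes "conj_closed_embedding \<iota>"
  shows "act \<iota> A \<omega> = superpoly_evaluation.evaluate (\<lambda>c. c) (\<lambda>i z. act_x \<iota> A i * z)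
    (\<lambda>i z. z * act_theta \<iota> A i) \<omega> 1"
proof -
  interpret superpoly_evaluation "\<lambda>c. c" "\<lambda>i z. act_x \<iota> A i * z" "\<lambda>i z. z * act_theta \<iota> A i"
    by (rule act_evaluation[OF assms])
  have pow: "((\<lambda>z. a * z) ^^ m) z = a ^ m * z" for a z :: "('b, 'a) superpoly" and m
    by (induction m) (simp_all add: mult.assoc)
  have x: "fold (\<lambda>i. (\<lambda>z. act_x \<iota> A i * z) ^^ e i) xs z =
      prod_list (map (\<lambda>i. act_x \<iota> A i ^ e i) xs) * z" for e z xs
  proof (induction xs arbitrary: z)
    case (Cons i xs)
    have "prod_list (map (\<lambda>i. act_x \<iota> A i ^ e i) xs) * act_x \<iota> A i ^ e i =
        act_x \<iota> A i ^ e i * prod_list (map (\<lambda>i. act_x \<iota> A i ^ e i) xs)"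
      by (rule power_commuting_commutes[symmetric]) (rule act_x_commute[symmetric])
    moreover have "fold (\<lambda>i. (\<lambda>z. act_x \<iota> A i * z) ^^ e i) (i # xs) z =
        prod_list (map (\<lambda>i. act_x \<iota> A i ^ e i) xs) * (act_x \<iota> A i ^ e i * z)"
      by (simp only: fold.simps o_apply Cons pow)
    ultimately show ?case
      by (simp only: list.map prod_list.Cons mult.assoc[symmetric])
  qed simp
  have theta: "fold (\<lambda>i z. z * act_theta \<iota> A i) xs z = z * prod_list (map (act_theta \<iota> A) xs)" for xs z
    by (induction xs arbitrary: z) (simp_all add: mult.assoc)
  show ?thesis
    by (simp add: act_def evaluate_def monomial_op_def x theta mult.assoc)
qed

lemma act_rules:
  assumes "conj_closed_embedding \<iota>"
  shows "act \<iota> A (\<omega> + \<omega>') = act \<iota> A \<omega> + act \<iota> A \<omega>'"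
    and "act \<iota> A (const c) = const c"
    and "act \<iota> A (const c * \<omega>) = const c * act \<iota> A \<omega>"
    and "act \<iota> A (xvar i * \<omega>) = act_x \<iota> A i * act \<iota> A \<omega>"
    and "act \<iota> A (theta i * \<omega>) = act_theta \<iota> A i * act \<iota> A \<omega>"
proof -
  interpret superpoly_evaluation "\<lambda>c. c" "\<lambda>i z. act_x \<iota> A i * z" "\<lambda>i z. z * act_theta \<iota> A i"
    by (rule act_evaluation[OF assms])
  have eq: "act \<iota> A \<omega> = evaluate \<omega> 1" for \<omega>
    by (rule act_eq_evaluate[OF assms])
  have mult: "z * evaluate \<omega> 1 = evaluate \<omega> z" for z
  proof -
    have "(\<lambda>w. z * w) (evaluate \<omega> 1) = evaluate \<omega> ((\<lambda>w. z * w) 1)"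
    proof (rule evaluate_commute)
      show "const_linear (\<lambda>w. z * w)"
        by (simp add: const_linear_def distrib_left const_left_commute[of z])
      show "z * (act_x \<iota> A i * w) = act_x \<iota> A i * (z * w)" for i w
        unfolding mult.assoc[symmetric] act_x_commute[of z] ..
      show "z * (w * act_theta \<iota> A i) = z * w * act_theta \<iota> A i" for i w
        by (simp add: mult.assoc)
    qed
    then show ?thesis by simp
  qed
  show "act \<iota> A (\<omega> + \<omega>') = act \<iota> A \<omega> + act \<iota> A \<omega>'"
    and "act \<iota> A (const c) = const c"
    and "act \<iota> A (const c * \<omega>) = const c * act \<iota> A \<omega>"
    and "act \<iota> A (xvar i * \<omega>) = act_x \<iota> A i * act \<iota> A \<omega>"
    and "act \<iota> A (theta i * \<omega>) = act_theta \<iota> A i * act \<iota> A \<omega>"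
    by (simp_all add: eq mult evaluate_rules)
qed

text \<open>
  The images of the variables differentiate and contract like the variables themselves, because the
  substitution uses the same matrix for the \<open>x\<^sub>j\<close> and the \<open>\<theta>\<^sub>j\<close>; this is the chain rule.
\<close>

lemma act_x_act_theta_rules:
  shows "ext_d (act_x \<iota> A i * \<omega>) = act_theta \<iota> A i * \<omega> + act_x \<iota> A i * ext_d \<omega>"
    and "ext_d (act_theta \<iota> A i * \<omega>) = - (act_theta \<iota> A i * ext_d \<omega>)"
    and "euler_contraction (act_x \<iota> A i * \<omega>) = act_x \<iota> A i * euler_contraction \<omega>"
    and "euler_contraction (act_theta \<iota> A i * \<omega>) = act_x \<iota> A i * \<omega> - act_theta \<iota> A i * euler_contraction \<omega>"
  by (simp_all add: act_x_def act_theta_def sum_distrib_right additive_sum mult.assoc ext_d_rules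
      euler_contraction_rules distrib_left right_diff_distrib sum.distrib sum_negf sum_subtractf)

lemma act_neg:
  assumes "conj_closed_embedding \<iota>"
  shows "act \<iota> A 0 = 0" "act \<iota> A (- \<omega>) = - act \<iota> A \<omega>" "act \<iota> A (\<omega> - \<omega>') = act \<iota> A \<omega> - act \<iota> A \<omega>'"
    "act \<iota> A (\<Sum>i\<in>S. f i) = (\<Sum>i\<in>S. act \<iota> A (f i))"
proof -
  interpret additive "act \<iota> A"
    by standard (rule act_rules[OF assms])
  show "act \<iota> A 0 = 0" "act \<iota> A (- \<omega>) = - act \<iota> A \<omega>" "act \<iota> A (\<omega> - \<omega>') = act \<iota> A \<omega> - act \<iota> A \<omega>'"
    "act \<iota> A (\<Sum>i\<in>S. f i) = (\<Sum>i\<in>S. act \<iota> A (f i))"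
    by (rule zero, rule minus, rule diff, rule sum)
qed

lemma act_ext_d:
  assumes "conj_closed_embedding \<iota>"
  shows "act \<iota> A (ext_d \<omega>) = ext_d (act \<iota> A \<omega>)"
  by (induction \<omega> rule: superpoly_induct)
    (simp_all add: act_rules[OF assms] act_neg[OF assms] ext_d_rules act_x_act_theta_rules)

lemma act_euler_contraction:
  assumes "conj_closed_embedding \<iota>"
  shows "act \<iota> A (euler_contraction \<omega>) = euler_contraction (act \<iota> A \<omega>)"
  by (induction \<omega> rule: superpoly_induct)
    (simp_all add: act_rules[OF assms] act_neg[OF assms] euler_contraction_rules act_x_act_theta_rules)

section \<open>The ideal of invariants and the super harmonics\<close>

lemma ring_ring_of_type_algebra: "ring (ring_of_type_algebra :: 'a::ring_1 ring)"
proof -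
  have "\<exists>y. x + y = 0 \<and> y + x = 0" for x :: 'a
    by (rule exI[of _ "- x"]) simp
  then show ?thesis
    unfolding ring_of_type_algebra_def
    by unfold_locales (auto simp: algebra_simps Units_def)
qed

lemma ideal_ring_of_type_algebraI:
  fixes I :: "'a::ring_1 set"
  assumes zero: "0 \<in> I" and add: "\<And>a b. a \<in> I \<Longrightarrow> b \<in> I \<Longrightarrow> a + b \<in> I"
    and left: "\<And>x a. a \<in> I \<Longrightarrow> x * a \<in> I" and right: "\<And>x a. a \<in> I \<Longrightarrow> a * x \<in> I"
  shows "ideal I ring_of_type_algebra"
proof -
  interpret ring "ring_of_type_algebra :: 'a ring"
    by (rule ring_ring_of_type_algebra)
  have neg: "\<ominus>\<^bsub>ring_of_type_algebra\<^esub> a = - a" for a :: 'a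
    by (rule minus_equality) (simp_all add: ring_of_type_algebra_def)
  show ?thesis
  proof (rule idealI[OF ring_axioms])
    show "subgroup I (add_monoid (ring_of_type_algebra :: 'a ring))"
    proof
      fix a assume "a \<in> I"
      then show "inv\<^bsub>add_monoid ring_of_type_algebra\<^esub> a \<in> I"
        using left[of a "- 1"] neg[of a] by (simp add: a_inv_def)
    qed (simp_all add: ring_of_type_algebra_def assms(1,2))
  qed (simp_all add: ring_of_type_algebra_def assms(3,4))
qed

context
  fixes \<iota> :: "'k::field \<Rightarrow> complex" and G :: "('k, 'n::{finite,linorder}) square_matrix set"
begin

lemma invariant_ideal_closed:
  shows "(\<exists>a b. a + b > 0 \<and> bihomogeneous a b \<omega>) \<Longrightarrow> (\<And>A. A \<in> G \<Longrightarrow> act \<iota> A \<omega> = \<omega>) \<Longrightarrow>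
      \<omega> \<in> invariant_ideal \<iota> G"
    and "\<omega> \<in> invariant_ideal \<iota> G \<Longrightarrow> \<omega>' \<in> invariant_ideal \<iota> G \<Longrightarrow> \<omega> + \<omega>' \<in> invariant_ideal \<iota> G"
    and "\<omega> \<in> invariant_ideal \<iota> G \<Longrightarrow> \<eta> * \<omega> \<in> invariant_ideal \<iota> G"
    and "\<omega> \<in> invariant_ideal \<iota> G \<Longrightarrow> \<omega> * \<eta> \<in> invariant_ideal \<iota> G"
proof -
  let ?R = "ring_of_type_algebra :: ('n, 'k) superpoly ring"
  interpret ring ?R by (rule ring_ring_of_type_algebra)
  interpret ideal "invariant_ideal \<iota> G" ?R
    unfolding invariant_ideal_def
    by (rule genideal_ideal) (simp add: ring_of_type_algebra_def)
  show "(\<exists>a b. a + b > 0 \<and> bihomogeneous a b \<omega>) \<Longrightarrow> (\<And>A. A \<in> G \<Longrightarrow> act \<iota> A \<omega> = \<omega>) \<Longrightarrow>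
      \<omega> \<in> invariant_ideal \<iota> G"
    unfolding invariant_ideal_def
    by (rule subsetD[OF genideal_self]) (simp_all add: ring_of_type_algebra_def)
  show "\<omega> \<in> invariant_ideal \<iota> G \<Longrightarrow> \<omega>' \<in> invariant_ideal \<iota> G \<Longrightarrow> \<omega> + \<omega>' \<in> invariant_ideal \<iota> G"
    using a_closed[of \<omega> \<omega>'] by (simp add: ring_of_type_algebra_def)
  show "\<omega> \<in> invariant_ideal \<iota> G \<Longrightarrow> \<eta> * \<omega> \<in> invariant_ideal \<iota> G"
    and "\<omega> \<in> invariant_ideal \<iota> G \<Longrightarrow> \<omega> * \<eta> \<in> invariant_ideal \<iota> G"
    using I_l_closed[of \<omega> \<eta>] I_r_closed[of \<omega> \<eta>] by (simp_all add: ring_of_type_algebra_def)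
qed

text \<open>
  There is no case for zero, since zero is itself a generator.
\<close>

lemma invariant_ideal_induct [consumes 1, case_names generator add left right]:
  assumes "\<omega> \<in> invariant_ideal \<iota> G"
    and gen: "\<And>\<omega> a b. a + b > 0 \<Longrightarrow> bihomogeneous a b \<omega> \<Longrightarrow> (\<And>A. A \<in> G \<Longrightarrow> act \<iota> A \<omega> = \<omega>) \<Longrightarrow> P \<omega>"
    and add: "\<And>\<omega> \<eta>. P \<omega> \<Longrightarrow> P \<eta> \<Longrightarrow> P (\<omega> + \<eta>)"
    and left: "\<And>\<omega> \<eta>. P \<omega> \<Longrightarrow> P (\<eta> * \<omega>)"
    and right: "\<And>\<omega> \<eta>. P \<omega> \<Longrightarrow> P (\<omega> * \<eta>)"
  shows "P \<omega>"
proof -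
  let ?R = "ring_of_type_algebra :: ('n, 'k) superpoly ring"
  interpret ring ?R by (rule ring_ring_of_type_algebra)
  let ?gen = "{\<omega>. (\<exists>a b. a + b > 0 \<and> bihomogeneous a b \<omega>) \<and> (\<forall>A\<in>G. act \<iota> A \<omega> = \<omega>)}"
  have "invariant_ideal \<iota> G \<subseteq> Collect P"
    unfolding invariant_ideal_def
  proof (rule genideal_minimal)
    have "P 0"
      by (rule gen[of 0 1]) (simp_all add: bihomogeneous_def supp_def act_def)
    then show "ideal (Collect P) ?R"
      by (intro ideal_ring_of_type_algebraI) (auto intro: add left right)
  qed (auto intro: gen)
  with assms(1) show ?thesis by auto
qed

lemma bihomogeneous_iff:
  "bihomogeneous a b \<omega> \<longleftrightarrow> (\<forall>\<alpha> I. coeff \<omega> \<alpha> I \<noteq> 0 \<longrightarrow> xdegree \<alpha> = a \<and> card I = b)"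
  by (auto simp: bihomogeneous_def supp_def)

end

lemma coeff_ext_d_nonzero:
  fixes \<omega> :: "('n::{finite,linorder}, 'k::comm_ring_1) superpoly"
  assumes "coeff (ext_d \<omega>) \<alpha> I \<noteq> 0"
  obtains i where "i \<in> I" "coeff \<omega> (\<alpha> + Poly_Mapping.single i 1) (I - {i}) \<noteq> 0"
proof -
  from assms have "(\<Sum>i\<in>UNIV. coeff (theta i * deriv_x i \<omega>) \<alpha> I) \<noteq> 0"
    by (simp add: ext_d_alt)
  then obtain i where "coeff (theta i * deriv_x i \<omega>) \<alpha> I \<noteq> 0"
    by (rule sum.not_neutral_contains_not_neutral)
  then have "i \<in> I" "coeff \<omega> (\<alpha> + Poly_Mapping.single i 1) (I - {i}) \<noteq> 0"
    by (auto split: if_splits)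
  then show ?thesis by (rule that)
qed

lemma coeff_euler_contraction_nonzero:
  fixes \<omega> :: "('n::{finite,linorder}, 'k::comm_ring_1) superpoly"
  assumes "coeff (euler_contraction \<omega>) \<alpha> I \<noteq> 0"
  obtains i where "i \<notin> I" "Poly_Mapping.lookup \<alpha> i \<noteq> 0"
    "coeff \<omega> (\<alpha> - Poly_Mapping.single i 1) (insert i I) \<noteq> 0"
proof -
  from assms have "(\<Sum>i\<in>UNIV. coeff (xvar i * deriv_theta i \<omega>) \<alpha> I) \<noteq> 0"
    by (simp add: euler_contraction_def)
  then obtain i where "coeff (xvar i * deriv_theta i \<omega>) \<alpha> I \<noteq> 0"
    by (rule sum.not_neutral_contains_not_neutral)
  then have "i \<notin> I" "Poly_Mapping.lookup \<alpha> i \<noteq> 0"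
    "coeff \<omega> (\<alpha> - Poly_Mapping.single i 1) (insert i I) \<noteq> 0"
    by (auto split: if_splits)
  then show ?thesis by (rule that)
qed

text \<open>
  If \<open>a = 0\<close>, then \<open>ext_d \<omega> = 0\<close>, which is bihomogeneous of every bidegree; so the truncated
  difference is harmless. The same holds for the contraction when \<open>b = 0\<close>.
\<close>

lemma bihomogeneous_ext_d:
  fixes \<omega> :: "('n::{finite,linorder}, 'k::field) superpoly"
  assumes "bihomogeneous a b \<omega>"
  shows "bihomogeneous (a - 1) (b + 1) (ext_d \<omega>)"
  unfolding bihomogeneous_iff
proof (intro allI impI)
  fix \<alpha> I assume "coeff (ext_d \<omega>) \<alpha> I \<noteq> 0"
  then obtain i where i: "i \<in> I" "coeff \<omega> (\<alpha> + Poly_Mapping.single i 1) (I - {i}) \<noteq> 0"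
    by (rule coeff_ext_d_nonzero)
  then have "Suc (xdegree \<alpha>) = a" "card (I - {i}) = b"
    using assms xdegree_add_single[of \<alpha> i] by (auto simp: bihomogeneous_iff)
  with i(1) card_Suc_Diff1[of I i] show "xdegree \<alpha> = a - 1 \<and> card I = b + 1"
    by auto
qed

lemma bihomogeneous_euler_contraction:
  fixes \<omega> :: "('n::{finite,linorder}, 'k::field) superpoly"
  assumes "bihomogeneous a b \<omega>"
  shows "bihomogeneous (a + 1) (b - 1) (euler_contraction \<omega>)"
  unfolding bihomogeneous_iff
proof (intro allI impI)
  fix \<alpha> I assume "coeff (euler_contraction \<omega>) \<alpha> I \<noteq> 0"
  then obtain i where i: "i \<notin> I" "Poly_Mapping.lookup \<alpha> i \<noteq> 0"
    "coeff \<omega> (\<alpha> - Poly_Mapping.single i 1) (insert i I) \<noteq> 0"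
    by (rule coeff_euler_contraction_nonzero)
  then have "xdegree (\<alpha> - Poly_Mapping.single i 1) = a" "card (insert i I) = b"
    using assms by (auto simp: bihomogeneous_iff)
  with i show "xdegree \<alpha> = a + 1 \<and> card I = b - 1"
    using xdegree_minus_single[OF i(2)] by auto
qed

lemma bihomogeneous_parity_involution:
  fixes \<omega> :: "('n::{finite,linorder}, 'k::field) superpoly"
  assumes "bihomogeneous a b \<omega>"
  shows "parity_involution \<omega> = const ((- 1) ^ b) * \<omega>"
  using assms by (intro superpoly_eqI) (auto simp: bihomogeneous_iff)

text \<open>
  On a generator, both operators preserve invariance and the total degree, so they yield a generator,
  and the involution only multiplies by a sign. The product rules extend this to the whole ideal.
\<close>

lemma invariant_ideal_stable:
  fixes \<iota> :: "'k::field \<Rightarrow> complex" and G :: "('k, 'n::{finite,linorder}) square_matrix set"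
  assumes emb: "conj_closed_embedding \<iota>" and "\<omega> \<in> invariant_ideal \<iota> G"
  shows "parity_involution \<omega> \<in> invariant_ideal \<iota> G"
    and "ext_d \<omega> \<in> invariant_ideal \<iota> G"
    and "euler_contraction \<omega> \<in> invariant_ideal \<iota> G"
proof -
  let ?J = "invariant_ideal \<iota> G"
  note J = invariant_ideal_closed[where \<iota>=\<iota> and G=G]
  from assms(2) have "\<omega> \<in> ?J \<and> parity_involution \<omega> \<in> ?J \<and> ext_d \<omega> \<in> ?J \<and> euler_contraction \<omega> \<in> ?J"
  proof (induction rule: invariant_ideal_induct)
    case (generator \<omega> a b)
    have \<omega>: "\<omega> \<in> ?J"
      using generator by (intro J(1)) auto
    moreover have "parity_involution \<omega> \<in> ?J"
      unfolding bihomogeneous_parity_involution[OF generator(2)] by (rule J(3)[OF \<omega>])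
    moreover have "ext_d \<omega> \<in> ?J"
    proof (rule J(1))
      show "\<exists>a b. a + b > 0 \<and> bihomogeneous a b (ext_d \<omega>)"
        using bihomogeneous_ext_d[OF generator(2)] by (intro exI[of _ "a - 1"] exI[of _ "b + 1"]) simp
    qed (simp add: act_ext_d[OF emb] generator(3))
    moreover have "euler_contraction \<omega> \<in> ?J"
    proof (rule J(1))
      show "\<exists>a b. a + b > 0 \<and> bihomogeneous a b (euler_contraction \<omega>)"
        using bihomogeneous_euler_contraction[OF generator(2)]
        by (intro exI[of _ "a + 1"] exI[of _ "b - 1"]) simp
    qed (simp add: act_euler_contraction[OF emb] generator(3))
    ultimately show ?case by blast
  next
    case (add \<omega> \<eta>)
    then show ?case
      by (auto simp: parity_involution_rules(1) ext_d_rules(1) euler_contraction_rules(1) intro: J(2))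
  next
    case (left \<omega> \<eta>)
    then show ?case
      by (auto simp: parity_involution_times ext_d_times euler_contraction_times intro: J(2) J(3))
  next
    case (right \<omega> \<eta>)
    then show ?case
      by (auto simp: parity_involution_times ext_d_times euler_contraction_times intro: J(2) J(4))
  qed
  then show "parity_involution \<omega> \<in> ?J" "ext_d \<omega> \<in> ?J" "euler_contraction \<omega> \<in> ?J"
    by blast+
qed

lemma super_harmonicsD: "\<eta> \<in> super_harmonics \<iota> G \<Longrightarrow> \<omega> \<in> invariant_ideal \<iota> G \<Longrightarrow> diff_op \<iota> \<omega> \<eta> = 0"
  by (simp add: super_harmonics_def)

lemma super_harmonics_linear:
  assumes "conj_closed_embedding \<iota>" "\<eta> \<in> super_harmonics \<iota> G"
  shows "0 \<in> super_harmonics \<iota> G" "- \<eta> \<in> super_harmonics \<iota> G" "const c * \<eta> \<in> super_harmonics \<iota> G"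
    "\<zeta> \<in> super_harmonics \<iota> G \<Longrightarrow> \<eta> + \<zeta> \<in> super_harmonics \<iota> G"
  using assms(2) by (simp_all add: super_harmonics_def const_linearD[OF diff_op_rules(6)[OF assms(1)]])

text \<open>
  For \<open>\<omega>\<close> in the ideal, both terms in each adjointness relation vanish, since the operators
  preserve the ideal.
\<close>

lemma super_harmonics_ext_d:
  assumes emb: "conj_closed_embedding \<iota>" and "\<eta> \<in> super_harmonics \<iota> G"
  shows "ext_d \<eta> \<in> super_harmonics \<iota> G" "euler_contraction \<eta> \<in> super_harmonics \<iota> G"
  unfolding super_harmonics_def
  by (auto simp: diff_op_ext_d[OF emb] diff_op_euler_contraction[OF emb] super_harmonicsD[OF assms(2)]
      invariant_ideal_stable[OF emb])

text \<open>
  The constant term is multiplicative, so it vanishes on the ideal because it does on generators.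
\<close>

lemma super_harmonics_const:
  fixes \<iota> :: "'k::field \<Rightarrow> complex" and G :: "('k, 'n::{finite,linorder}) square_matrix set"
  assumes emb: "conj_closed_embedding \<iota>"
  shows "const c \<in> super_harmonics \<iota> G"
proof -
  have mult: "coeff (\<omega> * \<eta>) 0 {} = coeff \<omega> 0 {} * coeff \<eta> 0 {}" for \<omega> \<eta> :: "('n, 'k) superpoly"
    by (induction \<omega> rule: superpoly_induct) (simp_all add: distrib_right mult.assoc)
  have "coeff \<omega> 0 {} = 0" if "\<omega> \<in> invariant_ideal \<iota> G" for \<omega>
    using that
  proof (induction rule: invariant_ideal_induct)
    case (generator \<omega> a b)
    show ?case
    proof (rule ccontr)
      assume "coeff \<omega> 0 {} \<noteq> 0"
      with generator(2) have "xdegree (0 :: 'n \<Rightarrow>\<^sub>0 nat) = a" "card ({} :: 'n set) = b"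
        unfolding bihomogeneous_iff by blast+
      with generator(1) show False by (simp add: xdegree_def)
    qed
  qed (simp_all add: mult)
  then show ?thesis
    by (simp add: super_harmonics_def diff_op_constant[OF emb] conj_of_hom[OF emb] const_hom)
qed

section \<open>The top degree\<close>

text \<open>
  The action on linear forms has the conjugate matrix, so the conjugate of a fixed vector is the
  coefficient vector of an invariant form.
\<close>

lemma linear_theta_in_invariant_ideal:
  fixes \<iota> :: "'k::field \<Rightarrow> complex" and G :: "('k, 'n::{finite,linorder}) square_matrix set"
  assumes emb: "conj_closed_embedding \<iota>" and v: "v \<in> fixed_space G"
  shows "(\<Sum>j\<in>UNIV. const (conj_of \<iota> (v $ j)) * theta j) \<in> invariant_ideal \<iota> G"
proof (rule invariant_ideal_closed(1))
  let ?\<omega> = "(\<Sum>j\<in>UNIV. const (conj_of \<iota> (v $ j)) * theta j) :: ('n, 'k) superpoly"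
  have theta: "theta j = theta j * (const 1 :: ('n, 'k) superpoly)" for j
    by (simp add: const_hom)
  have coeff: "coeff (theta j :: ('n, 'k) superpoly) \<alpha> I = (if \<alpha> = 0 \<and> I = {j} then 1 else 0)" for j \<alpha> I
    by (auto simp: coeff_def basis_theta.rep_eq lookup_one when_def)
  have "bihomogeneous 0 1 ?\<omega>"
    unfolding bihomogeneous_iff
  proof (intro allI impI)
    fix \<alpha> I assume "coeff ?\<omega> \<alpha> I \<noteq> 0"
    then obtain j where "coeff (const (conj_of \<iota> (v $ j)) * theta j :: ('n, 'k) superpoly) \<alpha> I \<noteq> 0"
      unfolding coeff_sum by (rule sum.not_neutral_contains_not_neutral)
    then have "coeff (theta j :: ('n, 'k) superpoly) \<alpha> I \<noteq> 0"
      unfolding coeff_const_times by simp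
    then show "xdegree \<alpha> = 0 \<and> card I = 1"
      by (auto simp: coeff xdegree_def split: if_splits)
  qed
  then show "\<exists>a b. a + b > 0 \<and> bihomogeneous a b ?\<omega>"
    by (intro exI[of _ 0] exI[of _ 1]) simp
  fix A assume "A \<in> G"
  with v have Av: "A *v v = v" by (simp add: fixed_space_def)
  have act_theta: "act \<iota> A (theta j) = act_theta \<iota> A j" for j
    by (subst theta) (simp only: act_rules[OF emb], simp add: const_hom)
  have "act \<iota> A ?\<omega> = (\<Sum>j\<in>UNIV. \<Sum>i\<in>UNIV. const (conj_of \<iota> (v $ j) * conj_of \<iota> (A $ i $ j)) * theta i)"
    by (simp add: act_neg[OF emb] act_rules[OF emb] act_theta act_theta_def sum_distrib_left const_const_times)
  also have "\<dots> = (\<Sum>i\<in>UNIV. (\<Sum>j\<in>UNIV. const (conj_of \<iota> (A $ i $ j * v $ j)) * theta i))"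
    by (subst sum.swap) (simp add: conj_of_hom[OF emb] mult.commute)
  also have "\<dots> = (\<Sum>i\<in>UNIV. const (conj_of \<iota> ((A *v v) $ i)) * theta i)"
  proof -
    have "const (\<Sum>i\<in>S. f i) = (\<Sum>i\<in>S. const (f i) :: ('n, 'k) superpoly)" for S and f :: "'n \<Rightarrow> 'k"
      by (induction S rule: infinite_finite_induct) (simp_all add: const_hom)
    then show ?thesis
      by (simp add: matrix_vector_mult_def conj_of_sum[OF emb] sum_distrib_right)
  qed
  finally show "act \<iota> A ?\<omega> = ?\<omega>"
    unfolding Av .
qed

text \<open>
  The dimensions of \<open>V\<^sup>G\<close> and of the coordinate subspace add up to more than \<open>dim V\<close>.
\<close>

lemma fixed_space_meets_coordinate_subspace:
  fixes G :: "('k::field, 'n::finite) square_matrix set"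
  assumes "quotient_dim (fixed_space G) < card I"
  obtains w :: "('k, 'n) vec" where "w \<in> fixed_space G" "w \<noteq> 0" "\<And>i. i \<notin> I \<Longrightarrow> w $ i = 0"
proof -
  let ?W = "fixed_space G" and ?C = "{x :: 'k ^ 'n. \<forall>i. i \<notin> I \<longrightarrow> x $ i = 0}"
  have W: "vec.subspace ?W"
    unfolding vec.subspace_def fixed_space_def
    by (auto simp: matrix_vector_right_distrib vector_scalar_commute)
  have C: "vec.subspace ?C"
    using subspace_substandard_cart[of "\<lambda>i. i \<notin> I"] by simp
  have "vec.dim {x + y |x y. x \<in> ?W \<and> y \<in> ?C} + vec.dim (?W \<inter> ?C) = vec.dim ?W + vec.dim ?C"
    by (rule vec.dim_sums_Int[OF W C])
  moreover have "vec.dim {x + y |x y. x \<in> ?W \<and> y \<in> ?C} \<le> vec.dim (UNIV :: ('k ^ 'n) set)"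
    by (rule vec.dim_subset) simp
  moreover have "vec.dim ?W \<le> vec.dim (UNIV :: ('k ^ 'n) set)"
    by (rule vec.dim_subset) simp
  ultimately have "vec.dim (?W \<inter> ?C) \<noteq> 0"
    using assms dim_substandard_cart[of I, where 'a='k] unfolding quotient_dim_def by linarith
  then have "\<not> ?W \<inter> ?C \<subseteq> {0}"
    using vec.dim_subset[of "?W \<inter> ?C" "{0}"] by (auto simp: vec.dim_singleton)
  then show ?thesis using that by blast
qed

text \<open>
  Suppose that \<open>\<theta>\<^sub>I\<close> occurs in \<open>\<eta>\<close>, and let \<open>w\<close> be a non-zero fixed vector supported on
  \<open>I\<close>, say \<open>w\<^sub>i \<noteq> 0\<close>. Contraction with \<open>w\<close> kills \<open>\<eta>\<close>. In it, the coefficient of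
  \<open>\<theta>\<^bsub>I - {i}\<^esub>\<close> only receives contributions from \<open>\<theta>\<^bsub>insert j (I - {i})\<^esub>\<close> with
  \<open>w\<^sub>j \<noteq> 0\<close> and \<open>j \<notin> I - {i}\<close>, hence \<open>j = i\<close>; so the coefficient of \<open>\<theta>\<^sub>I\<close>
  is zero after all.
\<close>

lemma SH_above_top:
  fixes \<iota> :: "'k::field \<Rightarrow> complex" and G :: "('k, 'n::{finite,linorder}) square_matrix set"
  assumes emb: "conj_closed_embedding \<iota>" and k: "quotient_dim (fixed_space G) < k"
    and \<eta>: "\<eta> \<in> SH \<iota> G k"
  shows "\<eta> = 0"
proof (rule superpoly_eqI)
  fix \<alpha> I
  show "coeff \<eta> \<alpha> I = coeff 0 \<alpha> I"
  proof (rule ccontr)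
    assume nz: "coeff \<eta> \<alpha> I \<noteq> coeff 0 \<alpha> I"
    with \<eta> have "card I = k" by (auto simp: SH_def supp_def)
    with k obtain w where w: "w \<in> fixed_space G" "w \<noteq> 0" "\<And>i. i \<notin> I \<Longrightarrow> w $ i = 0"
      using fixed_space_meets_coordinate_subspace[of G I] by auto
    from w(2) obtain i where i: "w $ i \<noteq> 0" by (auto simp: vec_eq_iff)
    with w(3) have "i \<in> I" by blast
    let ?\<omega> = "(\<Sum>j\<in>UNIV. const (conj_of \<iota> (w $ j)) * theta j) :: ('n, 'k) superpoly"
    have theta: "diff_op \<iota> (theta j) \<eta> = deriv_theta j \<eta>" for j
      using diff_op_rules(5)[OF emb, of j "const 1" \<eta>] diff_op_rules(2)[OF emb, of 1]
      by (simp add: const_hom conj_of_hom[OF emb])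
    have sum: "diff_op \<iota> (\<Sum>j\<in>S. f j) \<eta> = (\<Sum>j\<in>S. diff_op \<iota> (f j) \<eta>)" for S and f :: "'n \<Rightarrow> ('n, 'k) superpoly"
      by (induction S rule: infinite_finite_induct) (simp_all add: diff_op_neg[OF emb] diff_op_rules(1)[OF emb])
    have "\<eta> \<in> super_harmonics \<iota> G"
      using \<eta> by (simp add: SH_def)
    then have "0 = diff_op \<iota> ?\<omega> \<eta>"
      by (rule super_harmonicsD[OF _ linear_theta_in_invariant_ideal[OF emb w(1)], symmetric])
    also have "\<dots> = (\<Sum>j\<in>UNIV. const (w $ j) * deriv_theta j \<eta>)"
      by (simp add: sum diff_op_rules(3)[OF emb] conj_of_hom[OF emb] theta)
    finally have "coeff 0 \<alpha> (I - {i}) = coeff (\<Sum>j\<in>UNIV. const (w $ j) * deriv_theta j \<eta>) \<alpha> (I - {i})"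
      by (rule arg_cong)
    then have "0 = (\<Sum>j\<in>UNIV. coeff (const (w $ j) * deriv_theta j \<eta>) \<alpha> (I - {i}))"
      unfolding coeff_zero coeff_sum .
    also have "\<dots> = (\<Sum>j\<in>UNIV. if j = i then w $ i * (sign_below i (I - {i}) * coeff \<eta> \<alpha> I) else 0)"
      using \<open>i \<in> I\<close> w(3) by (intro sum.cong) (auto simp: insert_absorb)
    finally show False
      using i nz by (simp add: sign_below_def)
  qed
qed

section \<open>Exactness\<close>

lemma SH_iff:
  "\<eta> \<in> SH \<iota> G k \<longleftrightarrow> \<eta> \<in> super_harmonics \<iota> G \<and> (\<forall>\<alpha> I. coeff \<eta> \<alpha> I \<noteq> 0 \<longrightarrow> card I = k)"
  by (auto simp: SH_def supp_def)

lemma SH_ext_d: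
  assumes "conj_closed_embedding \<iota>" "\<eta> \<in> SH \<iota> G k"
  shows "ext_d \<eta> \<in> SH \<iota> G (Suc k)"
  unfolding SH_iff
proof (intro conjI allI impI)
  show "ext_d \<eta> \<in> super_harmonics \<iota> G"
    using assms super_harmonics_ext_d by (auto simp: SH_iff)
  fix \<alpha> I assume "coeff (ext_d \<eta>) \<alpha> I \<noteq> 0"
  then obtain i where "i \<in> I" "coeff \<eta> (\<alpha> + Poly_Mapping.single i 1) (I - {i}) \<noteq> 0"
    by (rule coeff_ext_d_nonzero)
  with assms(2) card_Suc_Diff1[of I i] show "card I = Suc k"
    by (auto simp: SH_iff)
qed

lemma SH_euler_contraction:
  assumes "conj_closed_embedding \<iota>" "\<eta> \<in> SH \<iota> G (Suc k)"
  shows "euler_contraction \<eta> \<in> SH \<iota> G k"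
  unfolding SH_iff
proof (intro conjI allI impI)
  show "euler_contraction \<eta> \<in> super_harmonics \<iota> G"
    using assms super_harmonics_ext_d by (auto simp: SH_iff)
  fix \<alpha> I assume "coeff (euler_contraction \<eta>) \<alpha> I \<noteq> 0"
  then obtain i where "i \<notin> I" "coeff \<eta> (\<alpha> - Poly_Mapping.single i 1) (insert i I) \<noteq> 0"
    by (rule coeff_euler_contraction_nonzero)
  with assms(2) have "card (insert i I) = Suc k" by (auto simp: SH_iff)
  with \<open>i \<notin> I\<close> show "card I = k" by simp
qed

lemma SH_linear:
  assumes "conj_closed_embedding \<iota>"
  shows "0 \<in> SH \<iota> G k" "\<eta> \<in> SH \<iota> G k \<Longrightarrow> - \<eta> \<in> SH \<iota> G k"
    "\<eta> \<in> SH \<iota> G k \<Longrightarrow> const c * \<eta> \<in> SH \<iota> G k"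
    "\<eta> \<in> SH \<iota> G k \<Longrightarrow> \<zeta> \<in> SH \<iota> G k \<Longrightarrow> \<eta> + \<zeta> \<in> SH \<iota> G k"
proof -
  show "0 \<in> SH \<iota> G k"
    using super_harmonics_const[OF assms, of 0 G] by (simp add: SH_iff const_hom)
  show "\<eta> \<in> SH \<iota> G k \<Longrightarrow> \<zeta> \<in> SH \<iota> G k \<Longrightarrow> \<eta> + \<zeta> \<in> SH \<iota> G k"
  proof -
    assume "\<eta> \<in> SH \<iota> G k" "\<zeta> \<in> SH \<iota> G k"
    moreover have "coeff \<eta> \<alpha> I \<noteq> 0 \<or> coeff \<zeta> \<alpha> I \<noteq> 0" if "coeff (\<eta> + \<zeta>) \<alpha> I \<noteq> 0" for \<alpha> I
      using that by auto
    ultimately show ?thesis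
      using super_harmonics_linear(4)[OF assms, of \<eta> G \<zeta>] unfolding SH_iff by blast
  qed
qed (use super_harmonics_linear[OF assms, of \<eta> G] in \<open>auto simp: SH_iff\<close>)

text \<open>
  The space \<open>S\<close> is only known to be stable under \<open>E\<close>, not under projection to the homogeneous
  components or under the inverse of \<open>E\<close>. Therefore induct on the set of degrees that occur in
  \<open>\<eta>\<close>: the form \<open>\<eta>' = E \<eta> - a \<eta>\<close> lies in \<open>S\<close> and has no component of degree \<open>a\<close>,
  and a solution of \<open>E \<zeta>' = \<eta>'\<close> gives the solution \<open>(\<eta> - \<zeta>') / a\<close> for \<open>\<eta>\<close>.
\<close>

lemma degree_operator_surj:
  fixes S :: "('n::{finite,linorder}, 'k::field) superpoly set"
  defines "E \<equiv> \<lambda>\<omega>. ext_d (euler_contraction \<omega>) + euler_contraction (ext_d \<omega>)"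
  assumes char: "\<And>m. (of_nat m :: 'k) = 0 \<longleftrightarrow> m = 0"
    and S: "0 \<in> S" "\<And>\<omega> \<eta>. \<omega> \<in> S \<Longrightarrow> \<eta> \<in> S \<Longrightarrow> \<omega> + \<eta> \<in> S" "\<And>c \<omega>. \<omega> \<in> S \<Longrightarrow> const c * \<omega> \<in> S"
      "\<And>\<omega>. \<omega> \<in> S \<Longrightarrow> E \<omega> \<in> S"
    and \<eta>: "\<eta> \<in> S" "\<And>\<alpha> I. coeff \<eta> \<alpha> I \<noteq> 0 \<Longrightarrow> xdegree \<alpha> + card I \<noteq> 0"
  shows "\<exists>\<zeta>\<in>S. E \<zeta> = \<eta>"
proof -
  have coeff_E: "coeff (E \<omega>) \<alpha> I = of_nat (xdegree \<alpha> + card I) * coeff \<omega> \<alpha> I" for \<omega> \<alpha> I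
    unfolding E_def by (rule cartan_formula)
  have "\<exists>\<zeta>\<in>S. E \<zeta> = \<eta>"
    if "finite D" "0 \<notin> D" "\<eta> \<in> S" "\<And>\<alpha> I. coeff \<eta> \<alpha> I \<noteq> 0 \<Longrightarrow> xdegree \<alpha> + card I \<in> D" for D \<eta>
    using that
  proof (induction arbitrary: \<eta>)
    case empty
    then have "\<eta> = 0" by (intro superpoly_eqI) auto
    moreover have "E 0 = 0" by (rule superpoly_eqI) (simp add: coeff_E)
    ultimately show ?case using S(1) by blast
  next
    case (insert a D)
    let ?\<eta>' = "E \<eta> + const (- of_nat a) * \<eta>"
    have "\<exists>\<zeta>\<in>S. E \<zeta> = ?\<eta>'"
    proof (rule insert.IH)
      show "?\<eta>' \<in> S" using insert.prems(2) by (intro S)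
      fix \<alpha> I assume nz: "coeff ?\<eta>' \<alpha> I \<noteq> 0"
      then have "coeff \<eta> \<alpha> I \<noteq> 0" by (auto simp: coeff_E)
      moreover have "xdegree \<alpha> + card I \<noteq> a"
      proof
        assume "xdegree \<alpha> + card I = a"
        then have "coeff (E \<eta>) \<alpha> I = of_nat a * coeff \<eta> \<alpha> I" by (simp only: coeff_E)
        with nz show False by simp
      qed
      ultimately show "xdegree \<alpha> + card I \<in> D" using insert.prems(3)[of \<alpha> I] by auto
    qed (use insert.prems(1) in simp)
    then obtain \<zeta>' where \<zeta>': "\<zeta>' \<in> S" "E \<zeta>' = ?\<eta>'" by blast
    let ?\<zeta> = "const (inverse (of_nat a)) * (\<eta> + const (- 1) * \<zeta>')"
    have a: "(of_nat a :: 'k) \<noteq> 0" using insert.prems(1) char[of a] by auto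
    have "?\<zeta> \<in> S" using insert.prems(2) \<zeta>'(1) by (intro S)
    moreover have "E ?\<zeta> = \<eta>"
    proof (rule superpoly_eqI)
      fix \<alpha> :: "'n \<Rightarrow>\<^sub>0 nat" and I :: "'n set"
      let ?m = "of_nat (xdegree \<alpha> + card I) :: 'k"
      have "?m * coeff \<zeta>' \<alpha> I = ?m * coeff \<eta> \<alpha> I - of_nat a * coeff \<eta> \<alpha> I"
        using arg_cong[OF \<zeta>'(2), of "\<lambda>\<omega>. coeff \<omega> \<alpha> I"]
        unfolding coeff_add[of "E \<eta>"] coeff_E coeff_const_times by simp
      then have "inverse (of_nat a) * (?m * coeff \<eta> \<alpha> I - ?m * coeff \<zeta>' \<alpha> I) = coeff \<eta> \<alpha> I"
        using a by simp
      then show "coeff (E ?\<zeta>) \<alpha> I = coeff \<eta> \<alpha> I"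
        unfolding coeff_E by (simp add: algebra_simps)
    qed
    ultimately show ?case by blast
  qed
  from this[of "(\<lambda>(\<alpha>, I). xdegree \<alpha> + card I) ` supp \<eta>" \<eta>] show ?thesis
    using \<eta> finite_supp[of \<eta>] by (force simp: supp_def)
qed

text \<open>
  Solving \<open>E \<zeta> = \<eta>\<close> among the closed forms, rather than among all super harmonics, makes the
  term \<open>\<delta> d \<zeta>\<close> vanish.
\<close>

lemma SH_exact:
  fixes \<iota> :: "'k::field \<Rightarrow> complex" and G :: "('k, 'n::{finite,linorder}) square_matrix set"
  assumes emb: "conj_closed_embedding \<iota>" and \<eta>: "\<eta> \<in> SH \<iota> G (Suc k)" "ext_d \<eta> = 0"
  shows "\<eta> \<in> ext_d ` SH \<iota> G k"
proof -
  let ?S = "{\<eta> \<in> SH \<iota> G (Suc k). ext_d \<eta> = 0}"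
  have "\<exists>\<zeta>\<in>?S. ext_d (euler_contraction \<zeta>) + euler_contraction (ext_d \<zeta>) = \<eta>"
  proof (rule degree_operator_surj)
    fix \<omega> assume "\<omega> \<in> ?S"
    then show "ext_d (euler_contraction \<omega>) + euler_contraction (ext_d \<omega>) \<in> ?S"
      using SH_ext_d[OF emb SH_euler_contraction[OF emb]] by (auto simp: ext_d_square)
  next
    fix \<alpha> I assume "coeff \<eta> \<alpha> I \<noteq> 0"
    with \<eta> show "xdegree \<alpha> + card I \<noteq> 0" by (auto simp: SH_iff)
  qed (use \<eta> SH_linear[OF emb] conj_closed_embedding_of_nat_eq_0[OF emb] in
      \<open>auto simp: ext_d_rules\<close>)
  then obtain \<zeta> where "\<zeta> \<in> SH \<iota> G (Suc k)" "ext_d \<zeta> = 0"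
    "ext_d (euler_contraction \<zeta>) + euler_contraction (ext_d \<zeta>) = \<eta>" by blast
  then have "\<eta> = ext_d (euler_contraction \<zeta>)"
    by simp
  then show ?thesis
    using SH_euler_contraction[OF emb \<open>\<zeta> \<in> SH \<iota> G (Suc k)\<close>] by blast
qed

text \<open>
  In \<open>\<theta>\<close>-degree zero the contraction vanishes as well, so \<open>E \<eta> = 0\<close> and only degree zero
  survives.
\<close>

lemma SH_closed_functions:
  fixes \<iota> :: "'k::field \<Rightarrow> complex" and G :: "('k, 'n::{finite,linorder}) square_matrix set"
  assumes emb: "conj_closed_embedding \<iota>" and \<eta>: "\<eta> \<in> SH \<iota> G 0" "ext_d \<eta> = 0"
  shows "\<eta> \<in> range const"
proof -
  have "euler_contraction \<eta> = 0"
  proof (rule superpoly_eqI, rule ccontr)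
    fix \<alpha> I assume "coeff (euler_contraction \<eta>) \<alpha> I \<noteq> coeff 0 \<alpha> I"
    then obtain i where "coeff \<eta> (\<alpha> - Poly_Mapping.single i 1) (insert i I) \<noteq> 0"
      unfolding coeff_zero by (rule coeff_euler_contraction_nonzero)
    with \<eta>(1) have "card (insert i I) = 0" by (auto simp: SH_iff)
    then show False by simp
  qed
  then have E: "of_nat (xdegree \<alpha> + card I) * coeff \<eta> \<alpha> I = 0" for \<alpha> I
    using cartan_formula[of \<eta> \<alpha> I] \<eta>(2) by simp
  have "\<eta> = const (coeff \<eta> 0 {})"
  proof (rule superpoly_eqI)
    fix \<alpha> I
    show "coeff \<eta> \<alpha> I = coeff (const (coeff \<eta> 0 {})) \<alpha> I"
    proof (cases "xdegree \<alpha> + card I = 0")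
      case True
      then have "\<alpha> = 0" "I = {}" by (simp_all add: xdegree_eq_0_iff)
      then show ?thesis by simp
    next
      case False
      with E[of \<alpha> I] have "coeff \<eta> \<alpha> I = 0"
        unfolding mult_eq_0_iff conj_closed_embedding_of_nat_eq_0[OF emb] by blast
      with False show ?thesis by (auto simp: xdegree_eq_0_iff)
    qed
  qed
  then show ?thesis by blast
qed

lemma group_additive_group:
  assumes "0 \<in> M" "\<And>a b. a \<in> M \<Longrightarrow> b \<in> M \<Longrightarrow> a + b \<in> M" "\<And>a. a \<in> M \<Longrightarrow> - a \<in> M"
  shows "group (additive_group M)"
proof (rule groupI)
  fix x assume "x \<in> carrier (additive_group M)"
  with assms(3) show "\<exists>y\<in>carrier (additive_group M). y \<otimes>\<^bsub>additive_group M\<^esub> x = \<one>\<^bsub>additive_group M\<^esub>"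
    by (intro bexI[of _ "- x"]) (simp_all add: additive_group_def)
qed (use assms in \<open>simp_all add: additive_group_def add.assoc\<close>)

lemma kernel_additive_group:
  "kernel (additive_group M) (additive_group N) f = {x \<in> M. f x = 0}"
  by (simp add: kernel_def additive_group_def)

theorem theorem1p10:
  fixes \<iota> :: "'k::field \<Rightarrow> complex"
    and G :: "('k, 'n::{finite,linorder}) square_matrix set"
    and r :: nat
  assumes "conj_closed_embedding \<iota>"
    and "pseudo_reflection_group \<iota> G"
    and "r = quotient_dim (fixed_space G)"
  shows "exact_seq
    (additive_group {0} # map (\<lambda>k. additive_group (SH \<iota> G k)) (rev [0..<Suc r])
       @ [additive_group (range const), additive_group {0}],
     replicate (Suc r) ext_d @ [id, id])"
proof -
  note emb = assms(1)
  let ?K = "additive_group (range const :: ('n, 'k) superpoly set)"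
  let ?Z = "additive_group {0 :: ('n, 'k) superpoly}"
  let ?SH = "\<lambda>k. additive_group (SH \<iota> G k)"
  have Z: "group ?Z"
    by (rule group_additive_group) simp_all
  have K: "group ?K"
  proof (rule group_additive_group)
    show "(0 :: ('n, 'k) superpoly) \<in> range const"
      by (rule image_eqI[of _ _ 0]) (simp_all add: const_hom)
    fix a :: "('n, 'k) superpoly" assume "a \<in> range const"
    then show "- a \<in> range const"
      by (auto simp flip: const_hom(5))
    fix b :: "('n, 'k) superpoly" assume "b \<in> range const"
    with \<open>a \<in> range const\<close> show "a + b \<in> range const"
      by (auto simp flip: const_hom(3))
  qed
  have SH: "group (?SH k)" for k
    by (rule group_additive_group) (fact SH_linear[OF emb])+
  have const_SH: "range const \<subseteq> SH \<iota> G 0"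
    using super_harmonics_const[OF emb] by (auto simp: SH_iff)
  have carrier: "carrier (additive_group M) = M" for M :: "('n, 'k) superpoly set"
    by (simp add: additive_group_def)
  have start: "exact_seq ([?SH 0, ?K, ?Z], [id, id])"
  proof (rule exact_seq.extension)
    have "id \<in> hom ?Z ?K"
      using K by (auto simp: hom_def additive_group_def const_hom intro: range_eqI[of _ _ 0])
    then show "exact_seq ([?K, ?Z], [id])"
      using Z K by (intro exact_seq.unity) (simp add: group_hom_def group_hom_axioms_def)
    show "id \<in> hom ?K (?SH 0)"
      using const_SH by (auto simp: hom_def additive_group_def)
    show "kernel ?K (?SH 0) id = id ` carrier ?Z"
      unfolding kernel_additive_group carrier by (auto intro: range_eqI[of _ _ 0] simp: const_hom)
  qed (rule SH)
  have SH_list: "map ?SH (rev [0..<Suc m]) @ xs = ?SH m # map ?SH (rev [0..<m]) @ xs" for m xs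
    by simp
  \<comment> \<open>Exactness holds for every \<open>m\<close>; for \<open>m = Suc r\<close> the new term is zero.\<close>
  have "exact_seq (map ?SH (rev [0..<Suc m]) @ [?K, ?Z], replicate m ext_d @ [id, id])" for m
  proof (induction m)
    case 0
    have "map ?SH (rev [0..<Suc 0]) @ [?K, ?Z] = [?SH 0, ?K, ?Z]" by simp
    with start show ?case by (simp only: replicate_0 append_Nil)
  next
    case (Suc m)
    have d: "ext_d \<in> hom (?SH m) (?SH (Suc m))"
      by (auto simp: hom_def additive_group_def SH_ext_d[OF emb] ext_d_rules)
    show ?case
    proof (cases m)
      case 0
      have "kernel (?SH 0) (?SH (Suc 0)) ext_d = id ` carrier ?K"
        unfolding kernel_additive_group carrier
        using SH_closed_functions[OF emb] const_SH by (auto simp: ext_d_rules)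
      from exact_seq.extension[OF start SH d[unfolded 0] this]
      have "exact_seq ([?SH (Suc 0), ?SH 0, ?K, ?Z], [ext_d, id, id])" .
      moreover have "map ?SH (rev [0..<Suc (Suc 0)]) @ [?K, ?Z] = [?SH (Suc 0), ?SH 0, ?K, ?Z]" by simp
      ultimately show ?thesis
        unfolding 0 by (simp only: replicate_Suc replicate_0 append_Nil append_Cons)
    next
      case l: (Suc l)
      have "kernel (?SH m) (?SH (Suc m)) ext_d = ext_d ` carrier (?SH l)"
        unfolding kernel_additive_group carrier l
        using SH_exact[OF emb] SH_ext_d[OF emb] by (auto simp: ext_d_square)
      from exact_seq.extension[OF Suc.IH[unfolded SH_list l replicate_Suc append_Cons SH_list] SH
          d[unfolded l] this[unfolded l]]
      show ?thesis
        unfolding SH_list l replicate_Suc append_Cons .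
    qed
  qed
  from this[of "Suc r"] have "exact_seq (?SH (Suc r) # map ?SH (rev [0..<Suc r]) @ [?K, ?Z],
      replicate (Suc r) ext_d @ [id, id])"
    unfolding SH_list .
  moreover have "SH \<iota> G (Suc r) = {0}"
    using SH_above_top[OF emb, of G "Suc r"] SH_linear(1)[OF emb] assms(3) by auto
  ultimately show ?thesis by (simp only:)
qed

end
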